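(* Let $(X_t)_{t\ge0}$ be a rich Lévy-type process on $\mathbb{R}^d$ with symbol $q$, $q(x,0)=0$, and characteristics $(b,0,\nu)$. Suppose that $q$ has bounded coefficients and $b(x)=\int_{0<|y|<1}y\,\nu(x,dy)$ for all $x\in\mathbb{R}^d$. Let $\varepsilon>0$ and let $\alpha:\mathbb{R}^d\to[\varepsilon,1]$ be uniformly continuous such that $$\sup_{x\in\mathbb{R}^d}\int_{0<|y|\le1}|y|^{\alpha(x)-\varepsilon}\,\nu(x,dy)<\infty.$$ If either the sector condition holds, i.e. there is a constant $C>0$ with $|\operatorname{Im}q(x,\xi)|\le C\operatorname{Re}q(x,\xi)$ for all $x,\xi\in\mathbb{R}^d$, or $\beta_\infty^x\le\alpha(x)-\varepsilon$ for all $x\in\mathbb{R}^d$, then the Hölder space of variable order $$\mathcal{C}_0^{\alpha(\cdot)}:=\left\{f\in C_0(\mathbb{R}^d):\ \sup_{x\in\mathbb{R}^d}\sup_{0<|y|\le1}\frac{|f(x+y)-f(x)|}{|y|^{\alpha(x)}}<\infty\right\}$$ is contained in the domain of the generator $A$ of $(X_t)_{t\ge 0}$ and $$Af(x)=\int_{\mathbb{R}^d\setminus\{0\}}\left(f(x+y)-f(x)\right)\nu(x,dy)\qquad\text{for all }x\in\mathbb{R}^d,\ f\in\mathcal{C}_0^{\alpha(\cdot)}.$$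
   Context: $C_0(\mathbb{R}^d)$ is the space of continuous functions $\mathbb{R}^d\to\mathbb{R}$ vanishing at infinity. A Lévy-type process (= Feller process) $(X_t)_{t\ge0}$ on $\mathbb{R}^d$ is a Markov process with càdlàg sample paths whose transition semigroup $f\mapsto \mathbb{E}^{\bullet}f(X_t)$ is a Feller semigroup on $C_0(\mathbb{R}^d)$. Its generator $(A,\mathcal{D}(A))$ has as domain the set of $f\in C_0(\mathbb{R}^d)$ for which $\frac1t(\mathbb{E}^xf(X_t)-f(x))$ converges as $t\to0$, uniformly in $x\in\mathbb{R}^d$, to a function in $C_0(\mathbb{R}^d)$, and $Af$ is this limit. The process is called rich if $C_c^\infty(\mathbb{R}^d)\subseteq\mathcal{D}(A)$. For a rich process, $Af(x)=-\int_{\mathbb{R}^d}e^{ix\cdot\xi}q(x,\xi)\widehat f(\xi)\,d\xi$ for $f\in C_c^\infty(\mathbb{R}^d)$, where $\widehat f(\xi)=(2\pi)^{-d}\int_{\mathbb{R}^d} e^{-ix\cdot\xi}f(x)\,dx$ and $q$ is the symbol $$q(x,\xi)=q(x,0)-ib(x)\cdot\xi+\tfrac12\xi\cdot Q(x)\xi+\int_{\mathbb{R}^d\setminus\{0\}}\left(1-e^{iy\cdot\xi}+iy\cdot\xi\,\mathbf{1}_{(0,1)}(|y|)\right)\nu(x,dy).$$ For each $x$, $(b(x),Q(x),\nu(x,dy))$ is a Lévy triplet: $b(x)\in\mathbb{R}^d$, $Q(x)\in\mathbb{R}^{d\times d}$ symmetric positive semidefinite, $\nu(x,\cdot)$ a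 measure on $\mathbb{R}^d\setminus\{0\}$ with $\int\min\{|y|^2,1\}\,\nu(x,dy)<\infty$. The family $(b,Q,\nu)$ is called the characteristics; characteristics $(b,0,\nu)$ means $Q\equiv0$. Bounded coefficients means that there is $c>0$ with $|q(x,\xi)|\le c(1+|\xi|^2)$ for all $x,\xi\in\mathbb{R}^d$. The generalized Blumenthal–Getoor index at infinity at $x$ is $\beta_\infty^{x}:=\inf\{\gamma>0:\ \lim_{r\to\infty}r^{-\gamma}\sup_{|\xi|\le r}|q(x,\xi)|<\infty\}\in[0,2]$. *)

theory Defs
  imports "HOL-Probability.Probability"
begin

section \<open>Function spaces\<close>

definition C0 :: "(real ^ 'd::finite \<Rightarrow> real) set" where
  "C0 = {f. continuous_on UNIV f \<and> (f \<longlongrightarrow> 0) at_infinity}"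

primrec Ck :: "nat \<Rightarrow> (real ^ 'd::finite \<Rightarrow> real) set" where
  "Ck 0 = {f. continuous_on UNIV f}"
| "Ck (Suc k) = {f. f differentiable_on UNIV \<and>
      (\<forall>i. (\<lambda>x. frechet_derivative f (at x) (axis i 1)) \<in> Ck k)}"

definition Cc_infty :: "(real ^ 'd::finite \<Rightarrow> real) set" where
  "Cc_infty = {f. (\<forall>k. f \<in> Ck k) \<and> compact (closure {x. f x \<noteq> 0})}"

text \<open>The suprema are taken in the extended nonnegative reals, so that finiteness of the
  supremum expresses boundedness.\<close>

definition variable_holder_C0 ::
    "(real ^ 'd::finite \<Rightarrow> real) \<Rightarrow> (real ^ 'd \<Rightarrow> real) set" where
  "variable_holder_C0 \<alpha> = {f \<in> C0.
     (SUP x. SUP y\<in>{y. 0 < norm y \<and> norm y \<le> 1}.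
        ennreal (\<bar>f (x + y) - f x\<bar> / norm y powr \<alpha> x)) < \<infinity>}"


section \<open>Feller semigroups and their generators\<close>

definition feller_semigroup ::
    "(real \<Rightarrow> (real ^ 'd::finite \<Rightarrow> real) \<Rightarrow> real ^ 'd \<Rightarrow> real) \<Rightarrow> bool" where
  "feller_semigroup T \<longleftrightarrow>
     (\<forall>t\<ge>0. \<forall>f\<in>C0. T t f \<in> C0) \<and>
     (\<forall>t\<ge>0. \<forall>f\<in>C0. \<forall>g\<in>C0. \<forall>a b.
        T t (\<lambda>x. a * f x + b * g x) = (\<lambda>x. a * T t f x + b * T t g x)) \<and>
     (\<forall>f\<in>C0. T 0 f = f) \<and>
     (\<forall>s\<ge>0. \<forall>t\<ge>0. \<forall>f\<in>C0. T (s + t) f = T s (T t f)) \<and>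
     (\<forall>t\<ge>0. \<forall>f\<in>C0. (\<forall>x. 0 \<le> f x \<and> f x \<le> 1) \<longrightarrow> (\<forall>x. 0 \<le> T t f x \<and> T t f x \<le> 1)) \<and>
     (\<forall>f\<in>C0. uniform_limit UNIV (\<lambda>t. T t f) f (at_right 0))"

definition generator_limit ::
    "(real \<Rightarrow> (real ^ 'd::finite \<Rightarrow> real) \<Rightarrow> real ^ 'd \<Rightarrow> real)
      \<Rightarrow> (real ^ 'd \<Rightarrow> real) \<Rightarrow> (real ^ 'd \<Rightarrow> real) \<Rightarrow> bool" where
  "generator_limit T f g \<longleftrightarrow>
     g \<in> C0 \<and> uniform_limit UNIV (\<lambda>t x. (T t f x - f x) / t) g (at_right 0)"

definition generator_domain ::
    "(real \<Rightarrow> (real ^ 'd::finite \<Rightarrow> real) \<Rightarrow> real ^ 'd \<Rightarrow> real)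
      \<Rightarrow> (real ^ 'd \<Rightarrow> real) set" where
  "generator_domain T = {f \<in> C0. \<exists>g. generator_limit T f g}"

definition generator ::
    "(real \<Rightarrow> (real ^ 'd::finite \<Rightarrow> real) \<Rightarrow> real ^ 'd \<Rightarrow> real)
      \<Rightarrow> (real ^ 'd \<Rightarrow> real) \<Rightarrow> real ^ 'd \<Rightarrow> real" where
  "generator T f = (THE g. generator_limit T f g)"

lemma generator_limit_unique:
  assumes "generator_limit T f g" "generator_limit T f h"
  shows "g = h"
proof
  fix x
  have "((\<lambda>t. (T t f x - f x) / t) \<longlongrightarrow> g x) (at_right 0)"
    "((\<lambda>t. (T t f x - f x) / t) \<longlongrightarrow> h x) (at_right 0)"
    using assms unfolding generator_limit_def by (auto intro: tendsto_uniform_limitI)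
  then show "g x = h x"
    by (rule tendsto_unique[rotated]) simp
qed

lemma generator_eqI: "generator_limit T f g \<Longrightarrow> generator T f = g"
  unfolding generator_def by (blast intro: generator_limit_unique)


section \<open>Levy-type processes\<close>

text \<open>A universal Markov process: \<open>P x\<close> is the law under which the process starts at \<open>x\<close>; of \<open>M\<close>
  only the underlying measurable space is used, and \<open>X t\<close> only matters for \<open>t \<ge> 0\<close>.\<close>

definition natural_filtration ::
    "'w measure \<Rightarrow> (real \<Rightarrow> 'w \<Rightarrow> real ^ 'd::finite) \<Rightarrow> real \<Rightarrow> 'w measure" where
  "natural_filtration M X s =
     sigma (space M) {X r -` B \<inter> space M | r B. 0 \<le> r \<and> r \<le> s \<and> B \<in> sets borel}"

locale markov_process =
  fixes M :: "'w measure" and P :: "real ^ 'd::finite \<Rightarrow> 'w measure"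
    and X :: "real \<Rightarrow> 'w \<Rightarrow> real ^ 'd"
  assumes prob_space_P: "\<And>x. prob_space (P x)"
    and sets_P: "\<And>x. sets (P x) = sets M"
    and measurable_X: "\<And>t. 0 \<le> t \<Longrightarrow> X t \<in> measurable M borel"
    and initial: "\<And>x. AE \<omega> in P x. X 0 \<omega> = x"
    and measurable_transition: "\<And>t B. 0 \<le> t \<Longrightarrow> B \<in> sets borel \<Longrightarrow>
      (\<lambda>x. measure (P x) (X t -` B \<inter> space M)) \<in> borel_measurable borel"
    and markov_property: "\<And>x s t B. 0 \<le> s \<Longrightarrow> 0 \<le> t \<Longrightarrow> B \<in> sets borel \<Longrightarrow>
      AE \<omega> in P x. real_cond_exp (P x) (natural_filtration M X s)
          (\<lambda>\<omega>'. indicator B (X (s + t) \<omega>')) \<omega>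
        = measure (P (X s \<omega>)) (X t -` B \<inter> space M)"

definition cadlag :: "(real \<Rightarrow> real ^ 'd::finite) \<Rightarrow> bool" where
  "cadlag x \<longleftrightarrow> (\<forall>t\<ge>0. continuous (at_right t) x) \<and> (\<forall>t>0. \<exists>l. (x \<longlongrightarrow> l) (at_left t))"

definition transition_semigroup ::
    "(real ^ 'd::finite \<Rightarrow> 'w measure) \<Rightarrow> (real \<Rightarrow> 'w \<Rightarrow> real ^ 'd)
      \<Rightarrow> real \<Rightarrow> (real ^ 'd \<Rightarrow> real) \<Rightarrow> real ^ 'd \<Rightarrow> real" where
  "transition_semigroup P X t f x = (\<integral>\<omega>. f (X t \<omega>) \<partial>P x)"

locale levy_type_process = markov_process +
  assumes cadlag_paths: "\<And>\<omega>. \<omega> \<in> space M \<Longrightarrow> cadlag (\<lambda>t. X t \<omega>)"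
    and feller: "feller_semigroup (transition_semigroup P X)"

definition rich ::
    "(real \<Rightarrow> (real ^ 'd::finite \<Rightarrow> real) \<Rightarrow> real ^ 'd \<Rightarrow> real) \<Rightarrow> bool" where
  "rich T \<longleftrightarrow> Cc_infty \<subseteq> generator_domain T"


section \<open>Symbols and characteristics\<close>

definition fourier_transform :: "(real ^ 'd::finite \<Rightarrow> real) \<Rightarrow> real ^ 'd \<Rightarrow> complex" where
  "fourier_transform f \<xi> =
     complex_of_real (1 / (2 * pi) ^ CARD('d)) *
       (\<integral>x. iexp (- (x \<bullet> \<xi>)) * complex_of_real (f x) \<partial>lborel)"

definition has_symbol ::
    "(real \<Rightarrow> (real ^ 'd::finite \<Rightarrow> real) \<Rightarrow> real ^ 'd \<Rightarrow> real)
      \<Rightarrow> (real ^ 'd \<Rightarrow> real ^ 'd \<Rightarrow> complex) \<Rightarrow> bool" where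
  "has_symbol T q \<longleftrightarrow> (\<forall>f\<in>Cc_infty. \<forall>x. complex_of_real (generator T f x) =
      - (\<integral>\<xi>. iexp (x \<bullet> \<xi>) * q x \<xi> * fourier_transform f \<xi> \<partial>lborel))"

text \<open>A measure on \<open>\<real>\<^sup>d\<close> without the origin is encoded as a Borel measure on \<open>\<real>\<^sup>d\<close> that does not
  charge the origin.\<close>

definition levy_triplet ::
    "real ^ 'd::finite \<Rightarrow> real ^ 'd ^ 'd \<Rightarrow> (real ^ 'd) measure \<Rightarrow> bool" where
  "levy_triplet b Q \<nu> \<longleftrightarrow>
     transpose Q = Q \<and> (\<forall>\<xi>. 0 \<le> \<xi> \<bullet> (Q *v \<xi>)) \<and>
     sets \<nu> = sets borel \<and> emeasure \<nu> {0} = 0 \<and>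
     (\<integral>\<^sup>+ y. ennreal (min ((norm y)\<^sup>2) 1) \<partial>\<nu>) < \<infinity>"

definition has_characteristics ::
    "(real ^ 'd::finite \<Rightarrow> real ^ 'd \<Rightarrow> complex) \<Rightarrow> (real ^ 'd \<Rightarrow> real ^ 'd)
      \<Rightarrow> (real ^ 'd \<Rightarrow> real ^ 'd ^ 'd) \<Rightarrow> (real ^ 'd \<Rightarrow> (real ^ 'd) measure) \<Rightarrow> bool" where
  "has_characteristics q b Q \<nu> \<longleftrightarrow>
     (\<forall>x. levy_triplet (b x) (Q x) (\<nu> x)) \<and>
     (\<forall>x \<xi>. q x \<xi> = q x 0 - \<i> * complex_of_real (b x \<bullet> \<xi>)
        + complex_of_real (1 / 2 * (\<xi> \<bullet> (Q x *v \<xi>)))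
        + (LINT y:UNIV - {0}|\<nu> x.
             1 - iexp (y \<bullet> \<xi>)
               + \<i> * complex_of_real (y \<bullet> \<xi>) * indicator {0<..<1} (norm y)))"

definition bounded_coefficients ::
    "(real ^ 'd::finite \<Rightarrow> real ^ 'd \<Rightarrow> complex) \<Rightarrow> bool" where
  "bounded_coefficients q \<longleftrightarrow> (\<exists>c>0. \<forall>x \<xi>. norm (q x \<xi>) \<le> c * (1 + (norm \<xi>)\<^sup>2))"

definition sector_condition ::
    "(real ^ 'd::finite \<Rightarrow> real ^ 'd \<Rightarrow> complex) \<Rightarrow> bool" where
  "sector_condition q \<longleftrightarrow> (\<exists>C>0. \<forall>x \<xi>. \<bar>Im (q x \<xi>)\<bar> \<le> C * Re (q x \<xi>))"

definition blumenthal_getoor_infty ::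
    "(real ^ 'd::finite \<Rightarrow> real ^ 'd \<Rightarrow> complex) \<Rightarrow> real ^ 'd \<Rightarrow> real" where
  "blumenthal_getoor_infty q x = Inf {\<gamma>. 0 < \<gamma> \<and>
     (\<exists>L::real. ((\<lambda>r. r powr (- \<gamma>) * (SUP \<xi>\<in>cball 0 r. norm (q x \<xi>))) \<longlongrightarrow> L) at_top)}"

end

theory Submission
  imports Defs
begin

text \<open>
  The generator \<open>A\<close> is a closed operator, so it suffices to approximate \<open>f\<close> uniformly by
  functions \<open>u \<in> C\<^sub>c\<^sup>\<infinity>\<close> for which \<open>Au\<close> converges uniformly to the claimed integral. Soft thresholding
  followed by convolution with a bump of small support yields such \<open>u\<close>: since \<open>\<alpha>\<close> is uniformly
  continuous, \<open>\<bar>u (x + y) - u x\<bar> \<le> C \<bar>y\<bar>\<^bsup>\<alpha> x - \<epsilon>/2\<^esup>\<close> for \<open>\<bar>y\<bar> \<le> 1\<close>, with \<open>C\<close> independent of \<open>u\<close>.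
  The remaining half of \<open>\<epsilon>\<close> makes the contribution of jumps of size below \<open>\<delta>\<close> of order
  \<open>\<delta>\<^bsup>\<epsilon>/2\<^esup>\<close> uniformly in \<open>x\<close>, and the larger jumps have uniformly bounded mass.

  For \<open>u\<close> itself, inserting \<open>q(x, \<xi>) = \<integral> (1 - e\<^bsup>i y \<xi>\<^esup>) \<nu>(x, dy)\<close> into the Fourier representation of
  the generator and applying Fubini gives \<open>Au(x) = \<integral> (u (x + y) - u x) \<nu>(x, dy)\<close>. The bump is a
  product of one-dimensional ones, so decay and inversion of its Fourier transform are
  one-dimensional facts.
\<close>

section \<open>Smooth bump functions on the real line\<close>

text \<open>The symbol determines \<open>A\<close> on test functions only, and a function in the
  Hoelder space need not be differentiable, so everything hinges on estimates that survive
  approximation. The exponent is lost at one place: mollifying at x averages increments based at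
  nearby points x - z, where \<alpha> may be smaller than at x, and uniform continuity caps this
  loss at \<epsilon>/2. Uniformity in x rests on one number, the \<nu>(x)-integral of the function
  that is |y|^(\<alpha>(x) - \<epsilon>) for |y| <= 1 and 1 beyond: the moment hypothesis bounds its
  first part, bounded coefficients bound the mass of large jumps. Because \<alpha>(x) - \<epsilon>
  <= 1, small jumps have a finite first moment, so the prescribed drift cancels the compensator and
  the symbol takes its uncompensated form. The mollified function is only continuous with compact
  support: its Fourier transform is merely bounded, and all decay comes from the transform of the
  bump.\<close>

primrec differentiable_times :: "nat \<Rightarrow> (real \<Rightarrow> real) \<Rightarrow> bool" where
  "differentiable_times 0 f = True"
| "differentiable_times (Suc k) f =
     (\<exists>f'. (\<forall>x. (f has_real_derivative f' x) (at x)) \<and> differentiable_times k f')"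

definition smooth_real :: "(real \<Rightarrow> real) \<Rightarrow> bool" where
  "smooth_real f \<longleftrightarrow> (\<forall>k. differentiable_times k f)"

section \<open>Closure properties of differentiability of finite order\<close>

lemma differentiable_times_pred:
  "differentiable_times (Suc k) f \<Longrightarrow> differentiable_times k f"
proof (induction k arbitrary: f)
  case (Suc k)
  then obtain f' where "\<forall>x. (f has_real_derivative f' x) (at x)" "differentiable_times (Suc k) f'"
    by auto
  with Suc.IH[of f'] show ?case unfolding differentiable_times.simps(2)[of k f] by blast
qed simp

lemma differentiable_times_const: "differentiable_times k (\<lambda>x. c)"
proof (induction k arbitrary: c)
  case (Suc k)
  then show ?case by (auto intro!: exI[of _ "\<lambda>x. 0"])
qed simp

lemma differentiable_times_add:
  "differentiable_times k f \<Longrightarrow> differentiable_times k g \<Longrightarrow> differentiable_times k (\<lambda>x. f x + g x)"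
proof (induction k arbitrary: f g)
  case (Suc k)
  then obtain f' g' where d: "\<And>x. (f has_real_derivative f' x) (at x)" "differentiable_times k f'"
    "\<And>x. (g has_real_derivative g' x) (at x)" "differentiable_times k g'"
    by auto
  then show ?case using Suc.IH[of f' g'] by (auto intro!: exI[of _ "\<lambda>x. f' x + g' x"] DERIV_add)
qed simp

lemma differentiable_times_mult:
  "differentiable_times k f \<Longrightarrow> differentiable_times k g \<Longrightarrow> differentiable_times k (\<lambda>x. f x * g x)"
proof (induction k arbitrary: f g)
  case (Suc k)
  then obtain f' g' where d: "\<And>x. (f has_real_derivative f' x) (at x)" "differentiable_times k f'"
    "\<And>x. (g has_real_derivative g' x) (at x)" "differentiable_times k g'"
    by auto
  \<comment> \<open>The Leibniz rule pairs a derivative with an undifferentiated factor, whose order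
    has to be lowered from \<open>Suc k\<close> to \<open>k\<close> before the induction hypothesis
    applies.\<close>
  have "differentiable_times k (\<lambda>x. f' x * g x + g' x * f x)"
    using Suc d differentiable_times_pred by (intro differentiable_times_add) blast+
  moreover have "((\<lambda>x. f x * g x) has_real_derivative f' x * g x + g' x * f x) (at x)" for x
    using d by (intro DERIV_mult)
  ultimately show ?case by (auto intro!: exI[of _ "\<lambda>x. f' x * g x + g' x * f x"])
qed simp

lemma differentiable_times_affine:
  "differentiable_times k f \<Longrightarrow> differentiable_times k (\<lambda>x. f (a * x + c))"
proof (induction k arbitrary: f)
  case (Suc k)
  then obtain f' where d: "\<And>x. (f has_real_derivative f' x) (at x)" "differentiable_times k f'"
    by auto
  have "((\<lambda>x. f (a * x + c)) has_real_derivative f' (a * x + c) * a) (at x)" for x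
    by (rule DERIV_chain2[OF d(1)]) (auto intro!: derivative_eq_intros)
  moreover have "differentiable_times k (\<lambda>x. f' (a * x + c) * a)"
    using Suc.IH d by (intro differentiable_times_mult differentiable_times_const) auto
  ultimately show ?case by (auto intro!: exI[of _ "\<lambda>x. f' (a * x + c) * a"])
qed simp

text \<open>The derivative witnesses hidden in the existential of
  \<open>differentiable_times\<close> depend on the order; uniqueness of derivatives identifies all
  of them with \<open>deriv f\<close>.\<close>

lemma smooth_real_deriv: "smooth_real f \<Longrightarrow> (f has_real_derivative deriv f x) (at x)"
  and smooth_real_smooth_deriv: "smooth_real f \<Longrightarrow> smooth_real (deriv f)"
proof -
  have *: "(\<forall>x. (f has_real_derivative deriv f x) (at x)) \<and> differentiable_times k (deriv f)"
    if f: "smooth_real f" for k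
  proof -
    from f have "differentiable_times (Suc k) f" unfolding smooth_real_def by blast
    then obtain f' where d: "\<forall>x. (f has_real_derivative f' x) (at x)" "differentiable_times k f'"
      by auto
    then have "f' = deriv f" by (intro ext) (metis DERIV_imp_deriv)
    with d show ?thesis by simp
  qed
  then show "smooth_real f \<Longrightarrow> (f has_real_derivative deriv f x) (at x)"
    "smooth_real f \<Longrightarrow> smooth_real (deriv f)"
    by (auto simp: smooth_real_def[of "deriv f"])
qed

lemma smooth_real_continuous: "smooth_real f \<Longrightarrow> continuous_on S f"
  by (meson DERIV_isCont continuous_at_imp_continuous_on smooth_real_deriv)

text \<open>The classical exp(-1/x), flat at 0, with a polynomial in 1/x as a factor: this enlarges
  the single function to a family closed under differentiation.\<close>

definition flat_at_0 :: "real poly \<Rightarrow> real \<Rightarrow> real" where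
  "flat_at_0 p x = (if 0 < x then poly p (inverse x) * exp (- inverse x) else 0)"

lemma poly_times_exp_tendsto_0: "((\<lambda>t. poly p t * exp (- t)) \<longlongrightarrow> (0::real)) at_top"
proof -
  have "((\<lambda>t. \<Sum>i\<le>degree p. coeff p i * (t ^ i / exp t)) \<longlongrightarrow> (\<Sum>i\<le>degree p. coeff p i * 0)) at_top"
    by (intro tendsto_intros tendsto_power_div_exp_0)
  then show ?thesis
    by (simp add: poly_altdef sum_distrib_right exp_minus divide_inverse mult.assoc)
qed

text \<open>With t = 1/x one has dt/dx = -t^2, so p(t) exp(-t) has the derivative t^2 (p - p')(t)
  exp(-t), a member of the same family. At x = 0 the right difference quotient is t p(t) exp(-t),
  which vanishes as t tends to infinity.\<close>

lemma flat_at_0_DERIV: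
  "(flat_at_0 p has_real_derivative flat_at_0 (monom 1 2 * (p - pderiv p)) x) (at x)"
proof -
  consider "0 < x" | "x < 0" | "x = 0" by linarith
  then show ?thesis
  proof cases
    case 1
    have "((\<lambda>x. poly p (inverse x) * exp (- inverse x)) has_real_derivative
        flat_at_0 (monom 1 2 * (p - pderiv p)) x) (at x)"
      using 1 by (auto intro!: derivative_eq_intros poly_DERIV DERIV_chain2[OF poly_DERIV]
        simp: flat_at_0_def poly_monom field_simps power2_eq_square)
    moreover have ev: "\<forall>\<^sub>F y in nhds x. flat_at_0 p y = poly p (inverse y) * exp (- inverse y)"
      by (rule eventually_mono[OF eventually_nhds_in_open[of "{0<..}" x]])
        (use 1 in \<open>auto simp: flat_at_0_def\<close>)
    ultimately show ?thesis unfolding DERIV_cong_ev[OF refl ev refl] by blast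
  next
    case 2
    have "((\<lambda>x. 0) has_real_derivative flat_at_0 (monom 1 2 * (p - pderiv p)) x) (at x)"
      using 2 by (simp add: flat_at_0_def)
    moreover have ev: "\<forall>\<^sub>F y in nhds x. flat_at_0 p y = 0"
      by (rule eventually_mono[OF eventually_nhds_in_open[of "{..<0}" x]])
        (use 2 in \<open>auto simp: flat_at_0_def\<close>)
    ultimately show ?thesis unfolding DERIV_cong_ev[OF refl ev refl] by blast
  next
    case 3
    have "((\<lambda>y. flat_at_0 p y / y) \<longlongrightarrow> 0) (at_left 0)"
      by (rule tendsto_eventually) (auto simp: eventually_at_left_field flat_at_0_def intro: lt_ex)
    moreover have "((\<lambda>y. flat_at_0 p y / y) \<longlongrightarrow> 0) (at_right 0)"
    proof -
      have "((\<lambda>y. poly (monom 1 1 * p) (inverse y) * exp (- inverse y)) \<longlongrightarrow> 0) (at_right 0)"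
        using poly_times_exp_tendsto_0 filterlim_inverse_at_top_right by (rule filterlim_compose)
      then show ?thesis
        by (rule filterlim_cong[THEN iffD1, rotated -1])
          (auto simp: eventually_at_filter flat_at_0_def poly_monom divide_inverse)
    qed
    ultimately have "((\<lambda>y. flat_at_0 p y / y) \<longlongrightarrow> 0) (at 0)"
      by (simp add: filterlim_at_split)
    then show ?thesis using 3 by (simp add: has_field_derivative_iff flat_at_0_def)
  qed
qed

lemma flat_at_0_smooth: "differentiable_times k (flat_at_0 p)"
proof (induction k arbitrary: p)
  case (Suc k)
  with flat_at_0_DERIV[of p] show ?case unfolding differentiable_times.simps by blast
qed simp

lemma bump_exists:
  fixes \<delta> :: real
  assumes "0 < \<delta>"
  obtains \<rho> where "smooth_real \<rho>" "\<And>x. 0 \<le> \<rho> x" "\<And>x. \<delta> < \<bar>x\<bar> \<Longrightarrow> \<rho> x = 0"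
    "integrable lborel \<rho>" "integral\<^sup>L lborel \<rho> = 1"
proof -
  define h where "h = flat_at_0 1"
  \<comment> \<open>One factor vanishes to the left of \<open>-\<delta>\<close>, the other to the
    right of \<open>\<delta>\<close>. The arguments are spelled as \<open>a * x + c\<close> to match
    \<open>differentiable_times_affine\<close>.\<close>
  define r where "r x = h (1 * x + \<delta>) * h (- 1 * x + \<delta>)" for x
  have h0: "0 \<le> h x" for x by (simp add: h_def flat_at_0_def)
  have hmono: "h x \<le> h y" if "x \<le> y" for x y
    using that by (auto simp: h_def flat_at_0_def intro: le_imp_inverse_le)
  have hpos: "0 < h x" if "0 < x" for x using that by (simp add: h_def flat_at_0_def)
  have smooth: "smooth_real r"
    unfolding smooth_real_def r_def h_def
    by (intro allI differentiable_times_mult differentiable_times_affine flat_at_0_smooth)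
  have supp: "r x = 0" if "\<delta> < \<bar>x\<bar>" for x
    using that by (auto simp: r_def h_def flat_at_0_def)
  have r0: "0 \<le> r x" for x by (simp add: r_def h0)
  have int: "integrable lborel r"
  proof -
    have "integrable lborel (\<lambda>x. indicator {-\<delta>..\<delta>} x *\<^sub>R r x)"
      by (intro borel_integrable_compact smooth_real_continuous smooth) auto
    moreover have "(\<lambda>x. indicator {-\<delta>..\<delta>} x *\<^sub>R r x) = r"
      using supp by (intro ext) (auto simp: indicator_def, (meson abs_le_iff minus_le_iff not_le)+)
    ultimately show ?thesis by simp
  qed
  \<comment> \<open>Normalising requires a positive mass: for |x| <= \<delta>/2 both arguments of
    \<open>h\<close> are at least \<delta>/2, and \<open>h\<close> is monotone.\<close>
  have "0 < (h (\<delta>/2) * h (\<delta>/2)) * \<delta>"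
    using hpos[of "\<delta>/2"] assms by simp
  also have "\<dots> = (\<integral>x. (h (\<delta>/2) * h (\<delta>/2)) * indicator {-\<delta>/2..\<delta>/2} x \<partial>lborel)"
    using assms by simp
  also have "\<dots> \<le> integral\<^sup>L lborel r"
  proof (rule integral_mono[OF _ int])
    show "h (\<delta>/2) * h (\<delta>/2) * indicator {-\<delta>/2..\<delta>/2} x \<le> r x" for x
      using r0[of x] by (auto simp: indicator_def r_def intro!: mult_mono hmono h0)
  qed (use assms in auto)
  finally have pos: "0 < integral\<^sup>L lborel r" .
  show thesis
  proof (rule that[of "\<lambda>x. r x * inverse (integral\<^sup>L lborel r)"])
    show "smooth_real (\<lambda>x. r x * inverse (integral\<^sup>L lborel r))"
      using smooth unfolding smooth_real_def
      by (auto intro: differentiable_times_mult differentiable_times_const)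
  qed (use pos int r0 supp in auto)
qed

section \<open>Fourier inversion on the real line\<close>

text \<open>Supplies the joint integrability that Fubini demands: oscillating factors are bounded,
  so a majorant of product form is at hand.\<close>

lemma (in pair_sigma_finite) integrable_pair_bound:
  fixes h :: "'a \<times> 'b \<Rightarrow> 'c::{banach, second_countable_topology}" and f g :: "_ \<Rightarrow> real"
  assumes f: "integrable M1 f" and g: "integrable M2 g"
    and h: "h \<in> borel_measurable (M1 \<Otimes>\<^sub>M M2)"
    and le: "\<And>x y. x \<in> space M1 \<Longrightarrow> y \<in> space M2 \<Longrightarrow> norm (h (x, y)) \<le> \<bar>f x\<bar> * \<bar>g y\<bar>"
  shows "integrable (M1 \<Otimes>\<^sub>M M2) h"
proof (rule Bochner_Integration.integrable_bound[OF _ h])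
  show "integrable (M1 \<Otimes>\<^sub>M M2) (\<lambda>(x, y). f x * g y)"
    using f g by (intro Fubini_integrable) (auto simp: abs_mult)
  show "AE p in M1 \<Otimes>\<^sub>M M2. norm (h p) \<le> norm (case p of (x, y) \<Rightarrow> f x * g y)"
    using le by (auto simp: space_pair_measure abs_mult)
qed

text \<open>Left unnormalised so that it multiplies over coordinates without constants; the factor
  of \<open>fourier_transform\<close> is restored at the very end.\<close>

definition fourier_real :: "(real \<Rightarrow> real) \<Rightarrow> real \<Rightarrow> complex" where
  "fourier_real f t = (CLBINT x. iexp (- (t * x)) * complex_of_real (f x))"

lemma integrable_compact_support:
  fixes f :: "'a::euclidean_space \<Rightarrow> 'b::{banach, second_countable_topology}"
  assumes "continuous_on UNIV f" "\<And>x. r < norm x \<Longrightarrow> f x = 0"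
  shows "integrable lborel f"
proof -
  have "integrable lborel (\<lambda>x. indicator (cball 0 r) x *\<^sub>R f x)"
    using assms(1) by (intro borel_integrable_compact) (auto intro: continuous_on_subset)
  moreover have "(\<lambda>x. indicator (cball 0 r) x *\<^sub>R f x) = f"
    using assms(2) by (intro ext) (auto simp: indicator_def not_le)
  ultimately show ?thesis by simp
qed

lemma deriv_eq_0_outside:
  assumes "\<And>x. r < \<bar>x\<bar> \<Longrightarrow> f x = (0::real)" "r < \<bar>x\<bar>"
  shows "deriv f x = 0"
proof -
  have "\<forall>\<^sub>F y in nhds x. f y = 0"
    by (rule eventually_mono[OF eventually_nhds_in_open[of "{y. r < \<bar>y\<bar>}" x]])
      (use assms in \<open>auto intro!: open_Collect_less continuous_intros\<close>)
  then have "(f has_real_derivative 0) (at x)"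
    by (subst DERIV_cong_ev[OF refl _ refl]) auto
  then show ?thesis by (rule DERIV_imp_deriv)
qed

lemma fourier_real_deriv:
  assumes f: "smooth_real f" and supp: "\<And>x. r < \<bar>x\<bar> \<Longrightarrow> f x = 0"
  shows "fourier_real (deriv f) t = \<i> * t * fourier_real f t"
proof -
  define F where "F x = iexp (- (t * x)) * complex_of_real (f x)" for x
  define F' where "F' x = iexp (- (t * x)) * complex_of_real (deriv f x) - \<i> * t * F x" for x
  \<comment> \<open>Strictly beyond the support, so both boundary terms of the integration by parts
    vanish; the absolute value keeps the interval nonempty for negative \<open>r\<close>.\<close>
  define R where "R = \<bar>r\<bar> + 1"
  note cont = smooth_real_continuous[OF f] smooth_real_continuous[OF smooth_real_smooth_deriv[OF f]]
  have supp': "deriv f x = 0" if "r < \<bar>x\<bar>" for x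
    using supp that by (intro deriv_eq_0_outside[of r f]) auto
  have int: "integrable lborel F" "integrable lborel (\<lambda>x. iexp (- (t * x)) * complex_of_real (deriv f x))"
    unfolding F_def
    by (rule integrable_compact_support[of _ r];
        auto intro!: continuous_intros cont simp: supp supp')+
  have DF: "(F has_vector_derivative F' x) (at x within S)" for x S
  proof -
    have 1: "((\<lambda>x. complex_of_real (f x)) has_vector_derivative complex_of_real (deriv f x)) (at x within S)"
      by (rule has_vector_derivative_of_real[OF has_field_derivative_at_within[OF smooth_real_deriv[OF f]]])
    have 2: "((\<lambda>x. iexp (- (t * x))) has_vector_derivative - (\<i> * t) * iexp (- (t * x))) (at x within S)"
    proof -
      have "((\<lambda>z. exp (- (\<i> * of_real t * z))) has_field_derivative - (\<i> * t) * exp (- (\<i> * t * of_real x))) (at (of_real x))"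
        by (auto intro!: derivative_eq_intros)
      from has_vector_derivative_real_field[OF this, of S] show ?thesis
        by (simp add: mult.assoc)
    qed
    show ?thesis unfolding F_def F'_def
      by (rule has_vector_derivative_eq_rhs[OF has_vector_derivative_mult[OF 2 1]])
        (simp only: mult_minus_left mult.assoc diff_conv_add_uminus)
  qed
  have "(\<integral>x. indicator {-R..R} x *\<^sub>R F' x \<partial>lborel) = F R - F (- R)"
    unfolding R_def by (intro integral_FTC_Icc DF)
      (auto simp: F'_def F_def intro!: continuous_intros cont)
  also have "(\<lambda>x. indicator {-R..R} x *\<^sub>R F' x) = F'"
    by (intro ext) (auto simp: R_def F'_def F_def indicator_def supp supp')
  also have "F R - F (- R) = 0" by (simp add: F_def R_def supp)
  finally have "(CLBINT x. F' x) = 0" .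
  moreover have "(CLBINT x. F' x) = (CLBINT x. iexp (- (t * x)) * complex_of_real (deriv f x)) - (CLBINT x. \<i> * t * F x)"
    unfolding F'_def by (intro Bochner_Integration.integral_diff integrable_mult_right int)
  moreover have "(CLBINT x. \<i> * t * F x) = \<i> * t * fourier_real f t"
    by (simp add: fourier_real_def F_def)
  ultimately show ?thesis by (simp add: fourier_real_def)
qed

lemma fourier_real_bounded: "norm (fourier_real f t) \<le> (LBINT x. \<bar>f x\<bar>)"
  unfolding fourier_real_def
  by (rule integral_norm_bound[THEN order_trans]) (simp add: norm_mult)

text \<open>Each factor |t| is traded for one derivative, and \<open>deriv f\<close> is again smooth
  with support in the same interval.\<close>

lemma fourier_real_rapid_decay:
  assumes "smooth_real f" "\<And>x. r < \<bar>x\<bar> \<Longrightarrow> f x = 0"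
  shows "\<exists>K. \<forall>t. \<bar>t\<bar> ^ k * norm (fourier_real f t) \<le> K"
  using assms
proof (induction k arbitrary: f)
  case 0
  then show ?case using fourier_real_bounded[of f] by auto
next
  case (Suc k)
  from Suc.IH[OF smooth_real_smooth_deriv[OF Suc.prems(1)]]
  obtain K where "\<And>t. \<bar>t\<bar> ^ k * norm (fourier_real (deriv f) t) \<le> K"
    using deriv_eq_0_outside[of r f] Suc.prems by blast
  then show ?case
    using fourier_real_deriv[OF Suc.prems]
    by (intro exI[of _ K]) (simp add: norm_mult ac_simps)
qed

lemma fourier_real_measurable [measurable]:
  assumes [measurable]: "f \<in> borel_measurable borel"
  shows "fourier_real f \<in> borel_measurable borel"
  unfolding fourier_real_def by measurable

lemma integrable_inverse_1_plus_square_lborel: "integrable lborel (\<lambda>x::real. inverse (1 + x\<^sup>2))"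
  using integrable_inverse_1_plus_square by (simp add: set_integrable_def)

text \<open>The weight will pay for the linear growth of the uncompensated symbol in the frequency.
  Decay orders 0 and 3 suffice, since (1 + |t|)(1 + t^2) grows like |t|^3.\<close>

lemma fourier_real_weighted_integrable:
  assumes f: "smooth_real f" "\<And>x. r < \<bar>x\<bar> \<Longrightarrow> f x = 0"
  shows "integrable lborel (\<lambda>t. (1 + \<bar>t\<bar>) * norm (fourier_real f t))"
proof -
  have [measurable]: "f \<in> borel_measurable borel"
    using smooth_real_continuous[OF f(1)] by (rule borel_measurable_continuous_onI)
  obtain K0 K1 where K: "\<And>t. \<bar>t\<bar> ^ 0 * norm (fourier_real f t) \<le> K0"
      "\<And>t. \<bar>t\<bar> ^ 3 * norm (fourier_real f t) \<le> K1"
    using fourier_real_rapid_decay[where k = 0, OF f] fourier_real_rapid_decay[where k = 3, OF f]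
    by blast
  show ?thesis
  proof (rule Bochner_Integration.integrable_bound)
    show "integrable lborel (\<lambda>t. (4 * (K0 + K1)) * inverse (1 + t\<^sup>2))"
      by (intro integrable_mult_right integrable_inverse_1_plus_square_lborel)
    have "(1 + \<bar>t\<bar>) * norm (fourier_real f t) \<le> 4 * (K0 + K1) * inverse (1 + t\<^sup>2)" for t
    proof -
      have "(1 + \<bar>t\<bar>) * (1 + t\<^sup>2) \<le> 4 * (1 + \<bar>t\<bar> ^ 3)"
      proof (cases "\<bar>t\<bar> \<le> 1")
        case True
        then have "(1 + \<bar>t\<bar>) * (1 + t\<^sup>2) \<le> 2 * 2"
          by (intro mult_mono) (auto simp: abs_square_le_1)
        also have "\<dots> \<le> 4 * (1 + \<bar>t\<bar> ^ 3)" by simp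
        finally show ?thesis .
      next
        case False
        then have "1 \<le> \<bar>t\<bar>\<^sup>2" by (intro one_le_power) auto
        with False have "(1 + \<bar>t\<bar>) * (1 + \<bar>t\<bar>\<^sup>2) \<le> (2 * \<bar>t\<bar>) * (2 * \<bar>t\<bar>\<^sup>2)"
          by (intro mult_mono) (auto simp del: power2_abs)
        then show ?thesis by (simp add: power2_eq_square power3_eq_cube)
      qed
      then have "(1 + \<bar>t\<bar>) * (1 + t\<^sup>2) * norm (fourier_real f t) \<le> 4 * (1 + \<bar>t\<bar> ^ 3) * norm (fourier_real f t)"
        by (intro mult_right_mono) auto
      also have "\<dots> \<le> 4 * (K0 + K1)" using K[of t] by (simp add: algebra_simps)
      finally have "(1 + \<bar>t\<bar>) * norm (fourier_real f t) * (1 + t\<^sup>2) \<le> 4 * (K0 + K1)"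
        by (simp add: ac_simps)
      moreover have "0 < 1 + t\<^sup>2" by (simp add: add_pos_nonneg)
      ultimately show ?thesis
        unfolding divide_inverse[symmetric] by (simp only: pos_le_divide_eq)
    qed
    then have "norm ((1 + \<bar>t\<bar>) * norm (fourier_real f t)) \<le> norm (4 * (K0 + K1) * inverse (1 + t\<^sup>2))" for t
      using abs_ge_self[of "4 * (K0 + K1) * inverse (1 + t\<^sup>2)"] order_trans
      by (fastforce simp only: real_norm_def abs_mult abs_norm_cancel abs_of_nonneg[OF add_nonneg_nonneg[OF zero_le_one abs_ge_zero]])
    then show "AE t in lborel. norm ((1 + \<bar>t\<bar>) * norm (fourier_real f t))
        \<le> norm (4 * (K0 + K1) * inverse (1 + t\<^sup>2))"
      by (rule AE_I2)
  qed measurable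
qed

section \<open>Gaussian regularisation and the inversion formula\<close>

lemma gaussian_fourier:
  fixes \<delta> s :: real assumes "0 < \<delta>"
  shows "(CLBINT t. iexp (t * s) * complex_of_real (std_normal_density (\<delta> * t)))
    = complex_of_real (inverse \<delta> * exp (- (s / \<delta>)\<^sup>2 / 2))"
proof -
  have "(CLBINT t. iexp (t * s) * complex_of_real (std_normal_density (\<delta> * t)))
    = \<bar>1/\<delta>\<bar> *\<^sub>R (CLBINT u. iexp ((0 + (1/\<delta>) * u) * s) * complex_of_real (std_normal_density (\<delta> * (0 + (1/\<delta>) * u))))"
    using assms by (intro lborel_integral_real_affine) auto
  also have "(CLBINT u. iexp ((0 + (1/\<delta>) * u) * s) * complex_of_real (std_normal_density (\<delta> * (0 + (1/\<delta>) * u))))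
     = (CLBINT u. std_normal_density u *\<^sub>R iexp ((s/\<delta>) * u))"
  proof (intro Bochner_Integration.integral_cong refl)
    fix u
    have "\<delta> * (0 + (1/\<delta>) * u) = u" "(0 + (1/\<delta>) * u) * s = (s/\<delta>) * u" using assms by simp_all
    then show "iexp ((0 + (1/\<delta>) * u) * s) * complex_of_real (std_normal_density (\<delta> * (0 + (1/\<delta>) * u)))
      = std_normal_density u *\<^sub>R iexp ((s/\<delta>) * u)"
      by (simp only: scaleR_conv_of_real mult.commute)
  qed
  also have "\<dots> = char std_normal_distribution (s/\<delta>)"
    unfolding char_def by (subst integral_density) (auto simp: normal_density_nonneg)
  also have "\<dots> = complex_of_real (exp (- (s / \<delta>)\<^sup>2 / 2))"
    by (simp add: char_std_normal_distribution)
  finally show ?thesis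
    unfolding scaleR_conv_of_real using assms by (simp only: of_real_mult abs_of_pos zero_less_divide_1_iff inverse_eq_divide)
qed

text \<open>Fubini fails for the undamped double integral, so the Gaussian
  \<open>?N (\<delta> n * t)\<close> is inserted. After exchanging the integrals the damped
  expression is a Gaussian average of \<open>f\<close> around \<open>x\<close> at scale
  \<open>\<delta> n\<close>, which tends to \<open>f x\<close> by continuity; on the frequency side
  the damping disappears by dominated convergence.\<close>

lemma fourier_real_inversion:
  assumes cont: "continuous_on UNIV f" and supp: "\<And>x. r < \<bar>x\<bar> \<Longrightarrow> f x = 0"
    and int: "integrable lborel (fourier_real f)"
  shows "(CLBINT t. iexp (t * x) * fourier_real f t) = complex_of_real (2 * pi * f x)"
proof -
  let ?N = std_normal_density
  have [measurable]: "f \<in> borel_measurable borel"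
    using cont by (rule borel_measurable_continuous_onI)
  have fint: "integrable lborel f"
    using integrable_compact_support[OF cont, of r] supp by simp
  have N0: "?N (0::real) = 1 / sqrt (2 * pi)" by (simp add: std_normal_density_def)
  have Nle: "?N t \<le> ?N 0" for t by (simp add: std_normal_density_def divide_right_mono)
  obtain B where B: "\<And>x. \<bar>f x\<bar> \<le> B"
  proof -
    have "bounded (f ` cball 0 r)"
      using cont by (intro compact_imp_bounded compact_continuous_image) (auto intro: continuous_on_subset)
    then obtain b where "\<And>x. \<bar>x\<bar> \<le> r \<Longrightarrow> \<bar>f x\<bar> \<le> b"
      unfolding bounded_iff by (auto simp: image_iff) (metis mem_cball_0 real_norm_def)
    then have "\<bar>f x\<bar> \<le> max b 0" for x using supp[of x] by (cases "r < \<bar>x\<bar>") (auto simp: le_max_iff_disj)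
    then show thesis using that by blast
  qed
  define \<delta> where "\<delta> n = inverse (real (Suc n))" for n
  have \<delta>pos: "0 < \<delta> n" for n by (simp add: \<delta>_def)
  have \<delta>lim: "\<delta> \<longlonglongrightarrow> 0" unfolding \<delta>_def by (rule LIMSEQ_inverse_real_of_nat)
  have eq: "(CLBINT t. iexp (t * x) * fourier_real f t * ?N (\<delta> n * t))
      = complex_of_real (sqrt (2 * pi) * (LBINT v. f (x - \<delta> n * v) * ?N v))" for n
  proof -
    have Nd: "integrable lborel (\<lambda>t. ?N (\<delta> n * t))"
      using lborel_integrable_real_affine[of ?N "\<delta> n" 0] \<delta>pos[of n] by simp
    have "(CLBINT t. iexp (t * x) * fourier_real f t * ?N (\<delta> n * t))
      = (CLBINT t. CLBINT z. iexp (t * x) * (iexp (- (t * z)) * complex_of_real (f z)) * ?N (\<delta> n * t))"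
      unfolding fourier_real_def
      by (simp flip: integral_mult_left_zero integral_mult_right_zero)
    also have "\<dots> = (CLBINT z. CLBINT t. iexp (t * x) * (iexp (- (t * z)) * complex_of_real (f z)) * ?N (\<delta> n * t))"
      by (rule lborel_pair.Fubini_integral, rule lborel_pair.integrable_pair_bound[OF fint Nd])
        (auto simp: norm_mult)
    also have "\<dots> = (CLBINT z. complex_of_real (f z * (inverse (\<delta> n) * exp (- ((x - z) / \<delta> n)\<^sup>2 / 2))))"
    proof (rule Bochner_Integration.integral_cong[OF refl])
      fix z
      have "(CLBINT t. iexp (t * x) * (iexp (- (t * z)) * complex_of_real (f z)) * ?N (\<delta> n * t))
          = (CLBINT t. complex_of_real (f z) * (iexp (t * (x - z)) * ?N (\<delta> n * t)))"
        by (intro Bochner_Integration.integral_cong)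
          (auto simp: algebra_simps simp flip: exp_add)
      then show "(CLBINT t. iexp (t * x) * (iexp (- (t * z)) * complex_of_real (f z)) * ?N (\<delta> n * t))
          = complex_of_real (f z * (inverse (\<delta> n) * exp (- ((x - z) / \<delta> n)\<^sup>2 / 2)))"
        using gaussian_fourier[OF \<delta>pos, of "x - z"] by simp
    qed
    also have "\<dots> = complex_of_real (LBINT z. f z * (inverse (\<delta> n) * exp (- ((x - z) / \<delta> n)\<^sup>2 / 2)))"
      by (rule integral_complex_of_real)
    \<comment> \<open>The substitution z = x - \<open>\<delta> n\<close> v centres the Gaussian; its
      Jacobian cancels \<open>inverse (\<delta> n)\<close>.\<close>
    also have "(LBINT z. f z * (inverse (\<delta> n) * exp (- ((x - z) / \<delta> n)\<^sup>2 / 2)))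
       = \<bar>- \<delta> n\<bar> *\<^sub>R (LBINT v. f (x + - \<delta> n * v) * (inverse (\<delta> n) * exp (- ((x - (x + - \<delta> n * v)) / \<delta> n)\<^sup>2 / 2)))"
      using \<delta>pos[of n] by (intro lborel_integral_real_affine) auto
    also have "\<dots> = (LBINT v. sqrt (2 * pi) * (f (x - \<delta> n * v) * ?N v))"
    proof -
      have "(x - (x + - \<delta> n * v)) / \<delta> n = v" for v using \<delta>pos[of n] by simp
      then show ?thesis
        unfolding real_scaleR_def integral_mult_right_zero[symmetric]
        using \<delta>pos[of n] by (intro Bochner_Integration.integral_cong) (auto simp: std_normal_density_def)
    qed
    finally show ?thesis by simp
  qed
  have "(\<lambda>n. CLBINT t. iexp (t * x) * fourier_real f t * ?N (\<delta> n * t))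
     \<longlonglongrightarrow> (CLBINT t. iexp (t * x) * fourier_real f t * ?N 0)"
  proof (rule integral_dominated_convergence)
    show "integrable lborel (\<lambda>t. norm (fourier_real f t) * ?N 0)"
      using int by (intro integrable_mult_left integrable_norm)
    show "AE t in lborel. (\<lambda>n. iexp (t * x) * fourier_real f t * ?N (\<delta> n * t))
        \<longlonglongrightarrow> iexp (t * x) * fourier_real f t * ?N 0"
    proof (intro AE_I2 tendsto_intros)
      fix t
      have "isCont ?N 0"
        unfolding std_normal_density_def by (intro continuous_intros) auto
      moreover have "(\<lambda>n. \<delta> n * t) \<longlonglongrightarrow> 0"
        using tendsto_mult[OF \<delta>lim tendsto_const[of t]] by simp
      ultimately show "(\<lambda>n. ?N (\<delta> n * t)) \<longlonglongrightarrow> ?N 0"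
        by (rule isCont_tendsto_compose)
    qed
    show "AE t in lborel. norm (iexp (t * x) * fourier_real f t * ?N (\<delta> n * t)) \<le> norm (fourier_real f t) * ?N 0" for n
      by (auto simp: norm_mult normal_density_nonneg intro!: mult_left_mono Nle)
  qed auto
  moreover have "(\<lambda>n. complex_of_real (sqrt (2 * pi) * (LBINT v. f (x - \<delta> n * v) * ?N v)))
     \<longlonglongrightarrow> complex_of_real (sqrt (2 * pi) * (LBINT v. f x * ?N v))"
  proof (intro tendsto_intros integral_dominated_convergence)
    show "integrable lborel (\<lambda>v. B * ?N v)" by simp
    show "AE v in lborel. (\<lambda>n. f (x - \<delta> n * v) * ?N v) \<longlonglongrightarrow> f x * ?N v"
    proof (intro AE_I2 tendsto_intros)
      fix v
      have "isCont f x" using cont continuous_on_eq_continuous_at by blast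
      moreover have "(\<lambda>n. x - \<delta> n * v) \<longlonglongrightarrow> x"
        using tendsto_diff[OF tendsto_const[of x] tendsto_mult[OF \<delta>lim tendsto_const[of v]]] by simp
      ultimately show "(\<lambda>n. f (x - \<delta> n * v)) \<longlonglongrightarrow> f x"
        by (rule isCont_tendsto_compose)
    qed
    show "AE v in lborel. norm (f (x - \<delta> n * v) * ?N v) \<le> B * ?N v" for n
      by (auto simp: abs_mult normal_density_nonneg intro!: mult_right_mono B)
  qed auto
  ultimately have "(CLBINT t. iexp (t * x) * fourier_real f t * ?N 0)
     = complex_of_real (sqrt (2 * pi) * (LBINT v. f x * ?N v))"
    unfolding eq by (rule LIMSEQ_unique)
  \<comment> \<open>The damping leaves \<open>?N 0\<close>, that is 1 / sqrt (2 pi), on one side,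
    and passing to the normalised density leaves sqrt (2 pi) on the other; together they give the
    factor 2 pi.\<close>
  then have "(CLBINT t. iexp (t * x) * fourier_real f t) * complex_of_real (1 / sqrt (2 * pi))
      = complex_of_real (sqrt (2 * pi) * f x)"
    unfolding N0 by simp
  then have "(CLBINT t. iexp (t * x) * fourier_real f t) * complex_of_real (1 / sqrt (2 * pi) * sqrt (2 * pi))
      = complex_of_real ((sqrt (2 * pi) * sqrt (2 * pi)) * f x)"
    unfolding of_real_mult by (simp only: mult.assoc mult.commute mult.left_commute)
  then show ?thesis by simp
qed

section \<open>Convolution with product bumps\<close>

text \<open>\<open>lborel\<close> is the image of the product measure over \<open>Basis\<close>
  under the coordinate map, which reduces both claims to finite products of measures. The field type
  covers real bumps and complex Fourier integrands alike.\<close>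

lemma lborel_Basis_prod:
  fixes f :: "'a::euclidean_space \<Rightarrow> real \<Rightarrow> 'c::{real_normed_field, banach, second_countable_topology}"
  assumes "\<And>b. b \<in> Basis \<Longrightarrow> integrable lborel (f b)"
  shows integrable_lborel_Basis_prod: "integrable lborel (\<lambda>x. \<Prod>b\<in>Basis. f b (x \<bullet> b))"
    and integral_lborel_Basis_prod:
      "(\<integral>x. (\<Prod>b\<in>Basis. f b (x \<bullet> b)) \<partial>lborel) = (\<Prod>b\<in>Basis. integral\<^sup>L lborel (f b))"
proof -
  interpret product_sigma_finite "\<lambda>_::'a. lborel :: real measure" ..
  have [measurable]: "f b \<in> borel_measurable borel" if "b \<in> Basis" for b
    using borel_measurable_integrable[OF assms[OF that]] by simp
  have inner: "(\<Sum>c\<in>Basis. w c *\<^sub>R c) \<bullet> b = w b" if "b \<in> Basis" for w and b :: 'a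
    using that by simp
  have m: "(\<lambda>w. \<Sum>b\<in>Basis. w b *\<^sub>R b) \<in> measurable (\<Pi>\<^sub>M b\<in>Basis. lborel) (borel :: 'a measure)"
    by measurable
  have m2: "(\<lambda>x. \<Prod>b\<in>Basis. f b (x \<bullet> b)) \<in> borel_measurable borel"
    by measurable
  note pi = product_integrable_prod[OF finite_Basis assms] product_integral_prod[OF finite_Basis assms]
  show "integrable lborel (\<lambda>x. \<Prod>b\<in>Basis. f b (x \<bullet> b))"
    using pi(1) by (subst lborel_eq) (simp add: integrable_distr_eq[OF m m2] inner cong: prod.cong)
  show "(\<integral>x. (\<Prod>b\<in>Basis. f b (x \<bullet> b)) \<partial>lborel) = (\<Prod>b\<in>Basis. integral\<^sup>L lborel (f b))"
    using pi(2) by (subst lborel_eq) (simp add: integral_distr[OF m m2] inner cong: prod.cong)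
qed

lemma lborel_reflect:
  fixes f :: "'a::euclidean_space \<Rightarrow> 'b::{banach, second_countable_topology}"
  assumes [measurable]: "f \<in> borel_measurable borel"
  shows "(\<integral>z. f (x - z) \<partial>lborel) = (\<integral>z. f z \<partial>lborel)"
proof -
  have eq: "lborel = distr lborel borel (\<lambda>z. x - z)"
    using lborel_affine[of "-1" x] by (simp add: density_1)
  show ?thesis
    by (subst (2) eq) (simp add: integral_distr)
qed

lemma lborel_translate:
  fixes f :: "'a::euclidean_space \<Rightarrow> 'b::{banach, second_countable_topology}"
  assumes [measurable]: "f \<in> borel_measurable borel"
  shows "(\<integral>z. f (z - x) \<partial>lborel) = (\<integral>z. f z \<partial>lborel)"
proof -
  show ?thesis
    by (subst (2) lborel_distr_plus[of "- x", symmetric]) (simp add: integral_distr)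
qed

text \<open>A separate factor for each coordinate keeps the family closed under partial derivatives:
  differentiating in direction b only replaces \<open>\<rho> b\<close> by
  \<open>deriv (\<rho> b)\<close>.\<close>

definition bump_conv :: "('a::euclidean_space \<Rightarrow> real) \<Rightarrow> ('a \<Rightarrow> real \<Rightarrow> real) \<Rightarrow> 'a \<Rightarrow> real" where
  "bump_conv g \<rho> x = (\<integral>z. g z * (\<Prod>b\<in>Basis. \<rho> b ((x - z) \<bullet> b)) \<partial>lborel)"

section \<open>Smoothness and support of the convolution\<close>

lemma continuous_on_Basis_prod:
  fixes \<rho> :: "'a::euclidean_space \<Rightarrow> real \<Rightarrow> real"
  assumes \<rho>: "\<And>b. b \<in> Basis \<Longrightarrow> smooth_real (\<rho> b)" and h: "continuous_on S h"
  shows "continuous_on S (\<lambda>x. \<Prod>b\<in>Basis. \<rho> b (h x \<bullet> b))"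
proof (rule continuous_on_prod)
  fix b :: 'a assume "b \<in> Basis"
  show "continuous_on S (\<lambda>x. \<rho> b (h x \<bullet> b))"
    by (rule continuous_on_compose2[OF smooth_real_continuous[OF \<rho>[OF \<open>b \<in> Basis\<close>], of UNIV]])
      (auto intro: continuous_intros h)
qed

lemma smooth_real_measurable: "smooth_real f \<Longrightarrow> f \<in> borel_measurable borel"
  by (intro borel_measurable_continuous_onI smooth_real_continuous)

text \<open>Moves the convolution to a box that does not depend on x, where differentiation under
  the integral sign is available.\<close>

lemma bump_conv_eq_integral_cbox:
  assumes g: "continuous_on UNIV g" "\<And>z. r < norm z \<Longrightarrow> g z = 0"
    and \<rho>: "\<And>b. b \<in> Basis \<Longrightarrow> smooth_real (\<rho> b)" and box: "cball 0 r \<subseteq> cbox l u"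
  shows "(\<lambda>z. g z * (\<Prod>b\<in>Basis. \<rho> b ((x - z) \<bullet> b))) integrable_on cbox l u"
    and "bump_conv g \<rho> x = integral (cbox l u) (\<lambda>z. g z * (\<Prod>b\<in>Basis. \<rho> b ((x - z) \<bullet> b)))"
proof -
  let ?f = "\<lambda>z. g z * (\<Prod>b\<in>Basis. \<rho> b ((x - z) \<bullet> b))"
  have "integrable lborel ?f"
    using g(2) by (intro integrable_compact_support[of _ r])
      (auto intro!: continuous_on_mult continuous_on_Basis_prod continuous_on_diff continuous_on_const continuous_on_id g(1) \<rho>)
  from has_integral_integral_lborel[OF this]
  have "(?f has_integral bump_conv g \<rho> x) UNIV" unfolding bump_conv_def .
  moreover have eq: "?f = (\<lambda>z. if z \<in> cbox l u then ?f z else 0)"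
  proof
    fix z show "?f z = (if z \<in> cbox l u then ?f z else 0)"
    proof (cases "z \<in> cbox l u")
      case False
      then have "g z = 0" using g(2)[of z] box by (meson mem_cball_0 not_le subset_iff)
      with False show ?thesis by simp
    qed simp
  qed
  ultimately have "(?f has_integral bump_conv g \<rho> x) (cbox l u)"
    by (subst has_integral_restrict_UNIV[symmetric], subst eq[symmetric])
  then show "?f integrable_on cbox l u" "bump_conv g \<rho> x = integral (cbox l u) ?f"
    by (auto simp: integrable_on_def integral_unique)
qed

lemma bump_conv_has_derivative:
  fixes g :: "'a::euclidean_space \<Rightarrow> real"
  assumes g: "continuous_on UNIV g" "\<And>z. r < norm z \<Longrightarrow> g z = 0"
    and \<rho>: "\<And>b. b \<in> Basis \<Longrightarrow> smooth_real (\<rho> b)"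
  shows "(bump_conv g \<rho> has_derivative
    (\<lambda>h. \<Sum>b\<in>Basis. (h \<bullet> b) * bump_conv g (\<rho>(b := deriv (\<rho> b))) x)) (at x)"
proof -
  obtain l u :: 'a where box: "cball 0 r \<subseteq> cbox l u"
    using bounded_subset_cbox_symmetric[OF bounded_cball] by metis
  define P where "P b y t = g t * (\<Prod>c\<in>Basis. (\<rho>(b := deriv (\<rho> b))) c ((y - t) \<bullet> c))" for b y t
  have \<rho>': "smooth_real ((\<rho>(b := deriv (\<rho> b))) c)" if "c \<in> Basis" "b \<in> Basis" for b c
    using \<rho> that smooth_real_smooth_deriv by simp
  \<comment> \<open>\<open>leibniz_rule\<close> integrates the derivative as a vector, so the total
    derivative is packaged as a bounded linear map, the sum of partial derivatives times coordinate
    functionals.\<close>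
  define D :: "'a \<Rightarrow> 'a \<Rightarrow> 'a \<Rightarrow>\<^sub>L real" where
    "D y t = (\<Sum>b\<in>Basis. P b y t *\<^sub>R blinfun_inner_left b)" for y t
  have D: "blinfun_apply (D y t) h = (\<Sum>b\<in>Basis. P b y t * (h \<bullet> b))" for y t h
    by (simp add: D_def blinfun.sum_left blinfun.scaleR_left)
  have "((\<lambda>y. integral (cbox l u) (\<lambda>t. g t * (\<Prod>b\<in>Basis. \<rho> b ((y - t) \<bullet> b))))
      has_derivative blinfun_apply (integral (cbox l u) (D x))) (at x within UNIV)"
  proof (rule leibniz_rule)
    fix y t :: 'a
    have 1: "((\<lambda>y. \<rho> b ((y - t) \<bullet> b)) has_derivative (\<lambda>h. deriv (\<rho> b) ((y - t) \<bullet> b) * (h \<bullet> b))) (at y)"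
      if "b \<in> Basis" for b
    proof -
      have "(\<rho> b has_derivative (\<lambda>h. deriv (\<rho> b) ((y - t) \<bullet> b) * h)) (at ((y - t) \<bullet> b))"
        using smooth_real_deriv[OF \<rho>[OF that]] by (simp add: has_field_derivative_def)
      moreover have "((\<lambda>y. (y - t) \<bullet> b) has_derivative (\<lambda>h. h \<bullet> b)) (at y)"
        by (auto intro!: derivative_eq_intros)
      ultimately show ?thesis by (rule has_derivative_compose[rotated])
    qed
    have "((\<lambda>y. g t * (\<Prod>b\<in>Basis. \<rho> b ((y - t) \<bullet> b))) has_derivative
        (\<lambda>h. g t * (\<Sum>b\<in>Basis. deriv (\<rho> b) ((y - t) \<bullet> b) * (h \<bullet> b) * (\<Prod>c\<in>Basis - {b}. \<rho> c ((y - t) \<bullet> c))))) (at y)"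
      by (intro has_derivative_mult_right has_derivative_prod 1)
    moreover have "P b y t = g t * (deriv (\<rho> b) ((y - t) \<bullet> b) * (\<Prod>c\<in>Basis - {b}. \<rho> c ((y - t) \<bullet> c)))"
      if "b \<in> Basis" for b
      unfolding P_def using that by (subst prod.remove[of _ b]) (auto intro!: prod.cong)
    then have "blinfun_apply (D y t) =
        (\<lambda>h. g t * (\<Sum>b\<in>Basis. deriv (\<rho> b) ((y - t) \<bullet> b) * (h \<bullet> b) * (\<Prod>c\<in>Basis - {b}. \<rho> c ((y - t) \<bullet> c))))"
      by (intro ext) (simp add: D sum_distrib_left ac_simps cong: sum.cong)
    ultimately show "((\<lambda>y. g t * (\<Prod>b\<in>Basis. \<rho> b ((y - t) \<bullet> b))) has_derivative blinfun_apply (D y t)) (at y within UNIV)"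
      by simp
  next
    show "continuous_on (UNIV \<times> cbox l u) (\<lambda>(y, t). D y t)"
      unfolding D_def P_def case_prod_unfold
      by (intro continuous_on_sum continuous_on_scaleR continuous_on_mult continuous_on_Basis_prod \<rho>'
        continuous_on_compose2[OF g(1)]) (auto intro!: continuous_intros)
  qed (use bump_conv_eq_integral_cbox(1)[OF g \<rho> box] in auto)
  moreover have "integral (cbox l u) (D x) = (\<Sum>b\<in>Basis. bump_conv g (\<rho>(b := deriv (\<rho> b))) x *\<^sub>R blinfun_inner_left b)"
  proof -
    have "((\<lambda>t. P b x t *\<^sub>R blinfun_inner_left b :: 'a \<Rightarrow>\<^sub>L real) has_integral
        bump_conv g (\<rho>(b := deriv (\<rho> b))) x *\<^sub>R blinfun_inner_left b) (cbox l u)" if "b \<in> Basis" for b :: 'a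
      unfolding P_def using bump_conv_eq_integral_cbox[OF g _ box, of "\<rho>(b := deriv (\<rho> b))" x] \<rho>' that
      by (intro has_integral_scaleR_left) (simp add: has_integral_iff)
    then show ?thesis unfolding D_def
      by (intro integral_unique has_integral_sum) auto
  qed
  moreover have "bump_conv g \<rho> = (\<lambda>y. integral (cbox l u) (\<lambda>t. g t * (\<Prod>b\<in>Basis. \<rho> b ((y - t) \<bullet> b))))"
    using bump_conv_eq_integral_cbox(2)[OF g \<rho> box] by auto
  moreover have "blinfun_apply (\<Sum>b\<in>Basis. bump_conv g (\<rho>(b := deriv (\<rho> b))) x *\<^sub>R blinfun_inner_left b)
     = (\<lambda>h. \<Sum>b\<in>Basis. (h \<bullet> b) * bump_conv g (\<rho>(b := deriv (\<rho> b))) x)"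
    by (auto simp: blinfun.sum_left blinfun.scaleR_left ac_simps)
  ultimately show ?thesis by simp
qed

lemma bump_conv_continuous:
  assumes "continuous_on UNIV g" "\<And>z. r < norm z \<Longrightarrow> g z = 0"
    and "\<And>b. b \<in> Basis \<Longrightarrow> smooth_real (\<rho> b)"
  shows "continuous_on UNIV (bump_conv g \<rho>)"
  by (rule has_derivative_continuous_on, rule has_derivative_at_withinI, rule bump_conv_has_derivative)
    (use assms in auto)

text \<open>All derivatives fall on the kernel, so \<open>g\<close> stays merely continuous while
  the induction varies \<open>\<rho>\<close>.\<close>

lemma bump_conv_Ck:
  fixes g :: "real ^ 'd::finite \<Rightarrow> real"
  assumes g: "continuous_on UNIV g" "\<And>z. r < norm z \<Longrightarrow> g z = 0"
    and "\<And>b. b \<in> Basis \<Longrightarrow> smooth_real (\<rho> b)"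
  shows "bump_conv g \<rho> \<in> Ck k"
  using assms(3)
proof (induction k arbitrary: \<rho>)
  case 0
  then show ?case using bump_conv_continuous[OF g] by simp
next
  case (Suc k)
  have d: "(bump_conv g \<rho> has_derivative
      (\<lambda>h. \<Sum>b\<in>Basis. (h \<bullet> b) * bump_conv g (\<rho>(b := deriv (\<rho> b))) x)) (at x)" for x
    using g Suc.prems by (rule bump_conv_has_derivative)
  have "(\<lambda>x. frechet_derivative (bump_conv g \<rho>) (at x) (axis i 1)) \<in> Ck k" for i
  proof -
    let ?b = "axis i (1::real)"
    have b: "?b \<in> Basis" by simp
    have "frechet_derivative (bump_conv g \<rho>) (at x) ?b = bump_conv g (\<rho>(?b := deriv (\<rho> ?b))) x" for x
    proof -
      have "frechet_derivative (bump_conv g \<rho>) (at x) ?b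
          = (\<Sum>b\<in>Basis. (?b \<bullet> b) * bump_conv g (\<rho>(b := deriv (\<rho> b))) x)"
        using frechet_derivative_at[OF d[of x], symmetric] by (rule fun_cong)
      also have "\<dots> = (\<Sum>b\<in>Basis. if b = ?b then bump_conv g (\<rho>(?b := deriv (\<rho> ?b))) x else 0)"
        using b by (intro sum.cong) (auto simp: inner_Basis)
      finally show ?thesis using b by simp
    qed
    moreover have "bump_conv g (\<rho>(?b := deriv (\<rho> ?b))) \<in> Ck k"
      using Suc.prems smooth_real_smooth_deriv b by (intro Suc.IH) auto
    ultimately show ?thesis by simp
  qed
  moreover have "bump_conv g \<rho> differentiable_on UNIV"
    using d by (auto simp: differentiable_on_def differentiable_def)
  ultimately show ?case by simp
qed

text \<open>The Euclidean norm is at most the sum of the absolute coordinates, so beyond this radius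
  some coordinate exceeds \<open>\<delta>\<close>.\<close>

lemma Basis_prod_eq_0:
  fixes x :: "'a::euclidean_space" and \<delta> :: real
  assumes "\<And>b t. b \<in> Basis \<Longrightarrow> \<delta> < \<bar>t\<bar> \<Longrightarrow> \<rho> b t = (0::real)" "DIM('a) * \<delta> < norm x"
  shows "(\<Prod>b\<in>Basis. \<rho> b (x \<bullet> b)) = 0"
proof -
  have "\<exists>b\<in>Basis. \<delta> < \<bar>x \<bullet> b\<bar>"
  proof (rule ccontr)
    assume "\<not> ?thesis"
    then have "(\<Sum>b\<in>Basis. \<bar>x \<bullet> b\<bar>) \<le> (\<Sum>b\<in>(Basis::'a set). \<delta>)"
      by (intro sum_mono) (auto simp: not_less)
    with norm_le_l1[of x] assms(2) show False by simp
  qed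
  then show ?thesis using assms(1) by (auto intro!: prod_zero)
qed

lemma bump_conv_support:
  fixes g :: "'a::euclidean_space \<Rightarrow> real" and r \<delta> :: real
  assumes g: "\<And>z. r < norm z \<Longrightarrow> g z = 0"
    and \<rho>: "\<And>b t. b \<in> Basis \<Longrightarrow> \<delta> < \<bar>t\<bar> \<Longrightarrow> \<rho> b t = 0"
    and x: "r + DIM('a) * \<delta> < norm x"
  shows "bump_conv g \<rho> x = 0"
proof -
  have "g z * (\<Prod>b\<in>Basis. \<rho> b ((x - z) \<bullet> b)) = 0" for z
  proof (cases "r < norm z")
    case False
    then have "DIM('a) * \<delta> < norm (x - z)" using x norm_triangle_ineq2[of x z] by linarith
    with Basis_prod_eq_0[of \<delta> \<rho> "x - z"] \<rho> show ?thesis by simp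
  qed (use g in simp)
  then have "bump_conv g \<rho> x = (\<integral>z. 0 \<partial>(lborel :: 'a measure))"
    unfolding bump_conv_def by (intro Bochner_Integration.integral_cong refl)
  then show ?thesis by simp
qed

lemma bump_conv_Cc_infty:
  fixes g :: "real ^ 'd::finite \<Rightarrow> real"
  assumes g: "continuous_on UNIV g" "\<And>z. r < norm z \<Longrightarrow> g z = 0"
    and \<rho>: "\<And>b. b \<in> Basis \<Longrightarrow> smooth_real (\<rho> b)"
      "\<And>b t. b \<in> Basis \<Longrightarrow> \<delta> < \<bar>t\<bar> \<Longrightarrow> \<rho> b t = 0"
  shows "bump_conv g \<rho> \<in> Cc_infty"
proof -
  have "{x. bump_conv g \<rho> x \<noteq> 0} \<subseteq> cball 0 (r + DIM(real^'d) * \<delta>)"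
    using bump_conv_support[of r g \<delta> \<rho>] g(2) \<rho>(2) by (force simp: not_less)
  then have "bounded {x. bump_conv g \<rho> x \<noteq> 0}"
    using bounded_subset bounded_cball by blast
  then show ?thesis
    using bump_conv_Ck[OF g \<rho>(1)] by (auto simp: Cc_infty_def compact_closure)
qed

text \<open>With the shift on \<open>g\<close>, increments of the convolution are averages of
  increments of \<open>g\<close>, to which a Hoelder bound applies.\<close>

lemma bump_conv_reflect:
  assumes g: "continuous_on UNIV g" and \<rho>: "\<And>b. b \<in> Basis \<Longrightarrow> smooth_real (\<rho> b)"
  shows "bump_conv g \<rho> x = (\<integral>z. g (x - z) * (\<Prod>b\<in>Basis. \<rho> b (z \<bullet> b)) \<partial>lborel)"
proof -
  have [measurable]: "(\<lambda>z. g (x - z) * (\<Prod>b\<in>Basis. \<rho> b (z \<bullet> b))) \<in> borel_measurable borel"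
    by (intro borel_measurable_continuous_onI continuous_on_mult continuous_on_Basis_prod \<rho>
      continuous_on_compose2[OF g]) (auto intro!: continuous_intros)
  show ?thesis unfolding bump_conv_def
    by (subst lborel_reflect[where x = x, symmetric]) simp_all
qed

lemma mollifier_average_bound:
  fixes h :: "'a::euclidean_space \<Rightarrow> real" and \<delta> e :: real
  assumes \<rho>: "smooth_real \<rho>" "\<And>t. 0 \<le> \<rho> t" "\<And>t. \<delta> < \<bar>t\<bar> \<Longrightarrow> \<rho> t = 0"
      "integrable lborel \<rho>" "integral\<^sup>L lborel \<rho> = 1"
    and h: "\<And>z. norm z \<le> DIM('a) * \<delta> \<Longrightarrow> \<bar>h z\<bar> \<le> e"
  shows "\<bar>\<integral>z. h z * (\<Prod>b\<in>Basis. \<rho> (z \<bullet> b)) \<partial>lborel\<bar> \<le> e"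
proof -
  have int: "integrable lborel (\<lambda>z::'a. \<Prod>b\<in>Basis. \<rho> (z \<bullet> b))"
    and one: "(\<integral>z. (\<Prod>b\<in>Basis. \<rho> (z \<bullet> b)) \<partial>(lborel :: 'a measure)) = 1"
    using integrable_lborel_Basis_prod[of "\<lambda>_::'a. \<rho>"] integral_lborel_Basis_prod[of "\<lambda>_::'a. \<rho>"] \<rho>
    by simp_all
  have pos: "0 \<le> (\<Prod>b\<in>Basis. \<rho> (z \<bullet> b))" for z :: 'a
    by (intro prod_nonneg) (simp add: \<rho>)
  \<comment> \<open>The majorant \<open>e\<close> times the bump must be nonnegative, which also
    covers an integrand that is not integrable and has the default integral 0. The bump has mass 1,
    hence is nonzero somewhere in the ball, and the bound on \<open>h\<close> there forces the sign
    of \<open>e\<close>.\<close>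
  have "0 \<le> e"
  proof -
    have "\<exists>z::'a. (\<Prod>b\<in>Basis. \<rho> (z \<bullet> b)) \<noteq> 0"
      using one by (metis (no_types, lifting) Bochner_Integration.integral_cong integral_zero zero_neq_one)
    then obtain z :: 'a where "norm z \<le> DIM('a) * \<delta>"
      using Basis_prod_eq_0[of \<delta> "\<lambda>_. \<rho>"] \<rho>(3) not_le by metis
    then show ?thesis using h[of z] by linarith
  qed
  have bound: "norm (h z * (\<Prod>b\<in>Basis. \<rho> (z \<bullet> b))) \<le> e * (\<Prod>b\<in>Basis. \<rho> (z \<bullet> b))" for z
  proof (cases "norm z \<le> DIM('a) * \<delta>")
    case True
    then show ?thesis using h[OF True] pos[of z] by (simp add: abs_mult mult_right_mono)
  next
    case False
    then have "(\<Prod>b\<in>Basis. \<rho> (z \<bullet> b)) = 0"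
      using \<rho>(3) by (intro Basis_prod_eq_0[of \<delta> "\<lambda>_. \<rho>"]) auto
    then show ?thesis by (simp only: mult_zero_right norm_zero order_refl)
  qed
  have "norm (\<integral>z. h z * (\<Prod>b\<in>Basis. \<rho> (z \<bullet> b)) \<partial>lborel) \<le> (\<integral>z. e * (\<Prod>b\<in>Basis. \<rho> (z \<bullet> b)) \<partial>(lborel :: 'a measure))"
    using \<open>0 \<le> e\<close> pos int bound
    by (intro order_trans[OF integral_norm_bound integral_mono']) auto
  then show ?thesis using one by simp
qed

section \<open>Fourier transforms of product bumps and of their convolutions\<close>

lemma iexp_inner_eq_prod:
  "iexp (- (x \<bullet> \<xi>)) = (\<Prod>b\<in>Basis. iexp (- ((\<xi> \<bullet> b) * (x \<bullet> b))))"
  by (subst exp_sum[symmetric])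
    (simp_all add: euclidean_inner[of x \<xi>] sum_distrib_left sum_negf mult.commute)

lemma le_one_plus_mult: "0 \<le> t \<Longrightarrow> 0 \<le> c \<Longrightarrow> c \<le> (1 + t) * (c::real)"
  by (simp add: algebra_simps)

definition fourier_prod :: "('a::euclidean_space \<Rightarrow> real \<Rightarrow> real) \<Rightarrow> 'a \<Rightarrow> complex" where
  "fourier_prod \<rho> \<xi> = (\<Prod>b\<in>Basis. fourier_real (\<rho> b) (\<xi> \<bullet> b))"

locale bump_family =
  fixes \<rho> :: "'a::euclidean_space \<Rightarrow> real \<Rightarrow> real" and \<delta> :: real
  assumes smooth: "\<And>b. b \<in> Basis \<Longrightarrow> smooth_real (\<rho> b)"
    and support: "\<And>b t. b \<in> Basis \<Longrightarrow> \<delta> < \<bar>t\<bar> \<Longrightarrow> \<rho> b t = 0"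
begin

abbreviation bump :: "'a \<Rightarrow> real" where "bump x \<equiv> (\<Prod>b\<in>Basis. \<rho> b (x \<bullet> b))"

lemma integrable_coordinate: "b \<in> Basis \<Longrightarrow> integrable lborel (\<rho> b)"
  using support smooth
  by (intro integrable_compact_support[of _ \<delta>] smooth_real_continuous) auto

lemma fourier_prod_eq_integral: "fourier_prod \<rho> \<xi> = (CLBINT x. iexp (- (x \<bullet> \<xi>)) * complex_of_real (bump x))"
proof -
  have "integrable lborel (\<lambda>t. iexp (- ((\<xi> \<bullet> b) * t)) * complex_of_real (\<rho> b t))" if "b \<in> Basis" for b
    using integrable_coordinate[OF that]
    by (rule Bochner_Integration.integrable_bound)
      (use smooth_real_measurable[OF smooth[OF that]] in \<open>auto simp: norm_mult\<close>)
  then have "(\<integral>x. (\<Prod>b\<in>Basis. iexp (- ((\<xi> \<bullet> b) * (x \<bullet> b))) * complex_of_real (\<rho> b (x \<bullet> b))) \<partial>lborel)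
      = fourier_prod \<rho> \<xi>"
    unfolding fourier_prod_def fourier_real_def by (rule integral_lborel_Basis_prod)
  then show ?thesis
    by (simp only: iexp_inner_eq_prod prod.distrib of_real_prod)
qed

lemma fourier_prod_measurable [measurable]: "fourier_prod \<rho> \<in> borel_measurable borel"
  unfolding fourier_prod_def[abs_def]
proof (rule borel_measurable_prod)
  fix b :: 'a assume "b \<in> Basis"
  show "(\<lambda>\<xi>. fourier_real (\<rho> b) (\<xi> \<bullet> b)) \<in> borel_measurable borel"
    by (rule measurable_compose[OF _ fourier_real_measurable[OF smooth_real_measurable[OF smooth[OF \<open>b \<in> Basis\<close>]]]])
      measurable
qed

text \<open>The weight itself is dominated by a product: 1 + |\<xi>| is at most 1 plus the sum of
  the absolute coordinates, hence at most the product of the factors 1 + |\<xi>_b|.\<close>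

lemma fourier_prod_weighted_integrable:
  "integrable lborel (\<lambda>\<xi>. (1 + norm \<xi>) * norm (fourier_prod \<rho> \<xi>))"
proof (rule Bochner_Integration.integrable_bound)
  show "integrable lborel (\<lambda>\<xi>::'a. \<Prod>b\<in>Basis. (1 + \<bar>\<xi> \<bullet> b\<bar>) * norm (fourier_real (\<rho> b) (\<xi> \<bullet> b)))"
    using support smooth
    by (intro integrable_lborel_Basis_prod fourier_real_weighted_integrable[of _ \<delta>]) auto
  show "AE \<xi> in lborel. norm ((1 + norm \<xi>) * norm (fourier_prod \<rho> \<xi>))
      \<le> norm (\<Prod>b\<in>Basis. (1 + \<bar>\<xi> \<bullet> b\<bar>) * norm (fourier_real (\<rho> b) (\<xi> \<bullet> b)))"
  proof (rule AE_I2)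
    fix \<xi> :: 'a
    have sum_prod: "1 + (\<Sum>b\<in>B. t b) \<le> (\<Prod>b\<in>B. 1 + t b)"
      if "finite B" "\<And>b. 0 \<le> t b" for B :: "'a set" and t :: "'a \<Rightarrow> real"
      using that(1)
    proof induction
      case (insert b B)
      have "1 + (t b + (\<Sum>c\<in>B. t c)) \<le> (1 + (\<Sum>c\<in>B. t c)) * (1 + t b)"
        using that(2) by (simp add: algebra_simps sum_nonneg)
      also have "\<dots> \<le> (\<Prod>c\<in>B. 1 + t c) * (1 + t b)"
        using insert that(2) by (intro mult_right_mono) auto
      finally show ?case using insert by (simp add: mult.commute)
    qed simp
    have "1 + norm \<xi> \<le> (\<Prod>b\<in>Basis. 1 + \<bar>\<xi> \<bullet> b\<bar>)"
      using norm_le_l1[of \<xi>] sum_prod[of Basis "\<lambda>b. \<bar>\<xi> \<bullet> b\<bar>"] by simp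
    then have "(1 + norm \<xi>) * norm (fourier_prod \<rho> \<xi>)
        \<le> (\<Prod>b\<in>Basis. 1 + \<bar>\<xi> \<bullet> b\<bar>) * norm (fourier_prod \<rho> \<xi>)"
      by (rule mult_right_mono) simp
    also have "\<dots> = (\<Prod>b\<in>Basis. (1 + \<bar>\<xi> \<bullet> b\<bar>) * norm (fourier_real (\<rho> b) (\<xi> \<bullet> b)))"
      unfolding fourier_prod_def prod.distrib by (simp only: prod_norm)
    finally show "norm ((1 + norm \<xi>) * norm (fourier_prod \<rho> \<xi>))
        \<le> norm (\<Prod>b\<in>Basis. (1 + \<bar>\<xi> \<bullet> b\<bar>) * norm (fourier_real (\<rho> b) (\<xi> \<bullet> b)))"
      by simp
  qed
qed measurable

lemma fourier_prod_integrable: "integrable lborel (fourier_prod \<rho>)"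
  by (rule Bochner_Integration.integrable_bound[OF fourier_prod_weighted_integrable])
    (auto simp: abs_mult intro!: AE_I2 le_one_plus_mult)

lemma fourier_prod_inversion:
  "(CLBINT \<xi>. iexp (x \<bullet> \<xi>) * fourier_prod \<rho> \<xi>) = complex_of_real ((2 * pi) ^ DIM('a) * bump x)"
proof -
  have fint: "integrable lborel (fourier_real (\<rho> b))" if "b \<in> Basis" for b
    by (rule Bochner_Integration.integrable_bound[OF fourier_real_weighted_integrable[of "\<rho> b" \<delta>]])
      (use smooth[OF that] support[OF that] in \<open>auto simp: abs_mult
        intro!: AE_I2 le_one_plus_mult fourier_real_measurable smooth_real_measurable\<close>)
  have int: "integrable lborel (\<lambda>t. iexp (t * (x \<bullet> b)) * fourier_real (\<rho> b) t)" if "b \<in> Basis" for b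
    by (rule Bochner_Integration.integrable_bound[OF fint[OF that]])
      (use smooth_real_measurable[OF smooth[OF that]] in \<open>auto simp: norm_mult\<close>)
  have "iexp (x \<bullet> \<xi>) = (\<Prod>b\<in>Basis. iexp ((\<xi> \<bullet> b) * (x \<bullet> b)))" for \<xi>
    using iexp_inner_eq_prod[of "- x" \<xi>] by simp
  then have "(CLBINT \<xi>. iexp (x \<bullet> \<xi>) * fourier_prod \<rho> \<xi>)
      = (CLBINT \<xi>. (\<Prod>b\<in>Basis. iexp ((\<xi> \<bullet> b) * (x \<bullet> b)) * fourier_real (\<rho> b) (\<xi> \<bullet> b)))"
    unfolding fourier_prod_def prod.distrib by simp
  also have "\<dots> = (\<Prod>b\<in>Basis. CLBINT t. iexp (t * (x \<bullet> b)) * fourier_real (\<rho> b) t)"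
    using integral_lborel_Basis_prod[OF int] .
  also have "\<dots> = (\<Prod>b\<in>Basis. complex_of_real (2 * pi * \<rho> b (x \<bullet> b)))"
    using smooth support fint by (intro prod.cong refl fourier_real_inversion[of _ \<delta>] smooth_real_continuous) auto
  also have "\<dots> = complex_of_real ((2 * pi) ^ DIM('a) * bump x)"
    unfolding of_real_prod[symmetric] prod.distrib by simp
  finally show ?thesis .
qed

lemma bump_continuous: "continuous_on S bump"
  by (intro continuous_on_Basis_prod smooth continuous_on_id)

lemma bump_measurable [measurable]: "bump \<in> borel_measurable borel"
  by (intro borel_measurable_continuous_onI bump_continuous)

lemma fourier_bump_conv:
  assumes g: "continuous_on UNIV g" "\<And>z. r < norm z \<Longrightarrow> g z = 0"
  shows "(CLBINT x. iexp (- (x \<bullet> \<xi>)) * complex_of_real (bump_conv g \<rho> x))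
    = (CLBINT z. iexp (- (z \<bullet> \<xi>)) * complex_of_real (g z)) * fourier_prod \<rho> \<xi>"
proof -
  define F where "F x z = iexp (- (x \<bullet> \<xi>)) * complex_of_real (g z * bump (x - z))" for x z
  have bump_diff: "continuous_on UNIV (\<lambda>p. bump (fst p - snd p))"
    by (rule continuous_on_compose2[OF bump_continuous[of UNIV]]) (auto intro!: continuous_intros)
  have "integrable (lborel \<Otimes>\<^sub>M lborel) (case_prod F)"
    unfolding lborel_prod
  proof (rule integrable_compact_support)
    show "continuous_on UNIV (case_prod F)"
      unfolding F_def case_prod_unfold
      by (intro continuous_intros bump_diff continuous_on_compose2[OF g(1)]) auto
    \<comment> \<open>If \<open>g\<close> does not vanish at z then |z| <= r, and |x - z| >= |x| -
      |z| >= |p| - 2 |z| lies beyond the support of the bump; hence the term 2 |r|.\<close>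
    show "case_prod F p = 0" if "2 * \<bar>r\<bar> + DIM('a) * \<delta> < norm p" for p
    proof (cases "r < norm (snd p)")
      case False
      have "norm p \<le> norm (fst p) + norm (snd p)"
        using norm_Pair_le[of "fst p" "snd p"] by simp
      then have "DIM('a) * \<delta> < norm (fst p - snd p)"
        using norm_triangle_ineq2[of "fst p" "snd p"] that False by linarith
      then have "bump (fst p - snd p) = 0" using support by (intro Basis_prod_eq_0) auto
      then show ?thesis unfolding F_def case_prod_unfold by (simp only: mult_zero_right of_real_0)
    qed (simp add: F_def case_prod_unfold g)
  qed
  note fub = lborel_pair.Fubini_integral[OF this]
  have "(CLBINT x. iexp (- (x \<bullet> \<xi>)) * complex_of_real (bump_conv g \<rho> x)) = (CLBINT x. CLBINT z. F x z)"
    unfolding F_def bump_conv_def integral_complex_of_real[symmetric] integral_mult_right_zero ..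
  also have "\<dots> = (CLBINT z. CLBINT x. F x z)" by (rule fub[symmetric])
  also have "\<dots> = (CLBINT z. iexp (- (z \<bullet> \<xi>)) * complex_of_real (g z) * fourier_prod \<rho> \<xi>)"
  proof (rule Bochner_Integration.integral_cong[OF refl])
    fix z
    have "(CLBINT x. F x z) = (CLBINT x. (iexp (- (z \<bullet> \<xi>)) * complex_of_real (g z)) *
        (iexp (- ((x - z) \<bullet> \<xi>)) * complex_of_real (bump (x - z))))"
    proof (rule Bochner_Integration.integral_cong[OF refl])
      fix x
      have "iexp (- (x \<bullet> \<xi>)) = iexp (- (z \<bullet> \<xi>)) * iexp (- ((x - z) \<bullet> \<xi>))"
        by (simp add: exp_add[symmetric] inner_diff_left algebra_simps)
      then show "F x z = (iexp (- (z \<bullet> \<xi>)) * complex_of_real (g z)) *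
        (iexp (- ((x - z) \<bullet> \<xi>)) * complex_of_real (bump (x - z)))"
        unfolding F_def by (simp only: of_real_mult ac_simps)
    qed
    also have "\<dots> = iexp (- (z \<bullet> \<xi>)) * complex_of_real (g z) *
        (CLBINT x. iexp (- ((x - z) \<bullet> \<xi>)) * complex_of_real (bump (x - z)))"
      by (rule integral_mult_right_zero)
    also have "(CLBINT x. iexp (- ((x - z) \<bullet> \<xi>)) * complex_of_real (bump (x - z))) = fourier_prod \<rho> \<xi>"
      unfolding fourier_prod_eq_integral
      by (rule lborel_translate[of "\<lambda>x. iexp (- (x \<bullet> \<xi>)) * complex_of_real (bump x)"]) measurable
    finally show "(CLBINT x. F x z) = iexp (- (z \<bullet> \<xi>)) * complex_of_real (g z) * fourier_prod \<rho> \<xi>" .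
  qed
  also have "\<dots> = (CLBINT z. iexp (- (z \<bullet> \<xi>)) * complex_of_real (g z)) * fourier_prod \<rho> \<xi>"
    by (rule integral_mult_left_zero)
  finally show ?thesis .
qed

text \<open>The transform of the continuous \<open>g\<close> need not be integrable, so inversion is
  never applied to it. Writing that transform out and exchanging integrals leaves the inversion of
  the bump alone, at the point x - z.\<close>

lemma fourier_bump_conv_inversion:
  assumes g: "continuous_on UNIV g" "\<And>z. r < norm z \<Longrightarrow> g z = 0"
  shows "(CLBINT \<xi>. iexp (x \<bullet> \<xi>) * ((CLBINT z. iexp (- (z \<bullet> \<xi>)) * complex_of_real (g z)) * fourier_prod \<rho> \<xi>))
    = complex_of_real ((2 * pi) ^ DIM('a) * bump_conv g \<rho> x)"
proof -
  define F where "F \<xi> z = iexp (x \<bullet> \<xi>) * (iexp (- (z \<bullet> \<xi>)) * complex_of_real (g z)) * fourier_prod \<rho> \<xi>"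
    for \<xi> z
  have [measurable]: "g \<in> borel_measurable borel" using g(1) by (rule borel_measurable_continuous_onI)
  have "case_prod F \<in> borel_measurable (lborel \<Otimes>\<^sub>M lborel)"
    unfolding F_def case_prod_unfold by measurable
  moreover have "integrable lborel g" using g by (rule integrable_compact_support)
  ultimately have "integrable (lborel \<Otimes>\<^sub>M lborel) (case_prod F)"
    using integrable_norm[OF fourier_prod_integrable]
    by (intro lborel_pair.integrable_pair_bound[where f = "\<lambda>\<xi>. norm (fourier_prod \<rho> \<xi>)" and g = g])
      (auto simp: F_def norm_mult)
  note fub = lborel_pair.Fubini_integral[OF this]
  have "(CLBINT \<xi>. iexp (x \<bullet> \<xi>) * ((CLBINT z. iexp (- (z \<bullet> \<xi>)) * complex_of_real (g z)) * fourier_prod \<rho> \<xi>))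
      = (CLBINT \<xi>. CLBINT z. F \<xi> z)"
    unfolding F_def integral_mult_right_zero integral_mult_left_zero by (simp only: mult.assoc)
  also have "\<dots> = (CLBINT z. CLBINT \<xi>. F \<xi> z)" by (rule fub[symmetric])
  also have "\<dots> = (CLBINT z. complex_of_real ((2 * pi) ^ DIM('a) * (g z * bump (x - z))))"
  proof (rule Bochner_Integration.integral_cong[OF refl])
    fix z
    have "(CLBINT \<xi>. F \<xi> z) = (CLBINT \<xi>. complex_of_real (g z) * (iexp ((x - z) \<bullet> \<xi>) * fourier_prod \<rho> \<xi>))"
    proof (rule Bochner_Integration.integral_cong[OF refl])
      fix \<xi>
      have "iexp ((x - z) \<bullet> \<xi>) = iexp (x \<bullet> \<xi>) * iexp (- (z \<bullet> \<xi>))"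
        by (simp add: exp_add[symmetric] inner_diff_left algebra_simps)
      then show "F \<xi> z = complex_of_real (g z) * (iexp ((x - z) \<bullet> \<xi>) * fourier_prod \<rho> \<xi>)"
        unfolding F_def by (simp only: ac_simps)
    qed
    also have "\<dots> = complex_of_real (g z) * complex_of_real ((2 * pi) ^ DIM('a) * bump (x - z))"
      unfolding integral_mult_right_zero fourier_prod_inversion ..
    finally show "(CLBINT \<xi>. F \<xi> z) = complex_of_real ((2 * pi) ^ DIM('a) * (g z * bump (x - z)))"
      by (simp only: of_real_mult ac_simps)
  qed
  also have "\<dots> = complex_of_real ((2 * pi) ^ DIM('a) * bump_conv g \<rho> x)"
    unfolding integral_complex_of_real bump_conv_def integral_mult_right_zero ..
  finally show ?thesis .
qed

end

text \<open>Collects what \<open>pseudo_differential_eq_jump_integral\<close> asks of the Fourier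
  side.\<close>

lemma fourier_transform_bump_conv:
  fixes \<rho> :: "real ^ 'd::finite \<Rightarrow> real \<Rightarrow> real"
  assumes \<rho>: "bump_family \<rho> \<delta>" and g: "continuous_on UNIV g" "\<And>z. r < norm z \<Longrightarrow> g z = 0"
  shows fourier_transform_bump_conv_inversion:
      "(CLBINT \<xi>. iexp (x \<bullet> \<xi>) * fourier_transform (bump_conv g \<rho>) \<xi>) = complex_of_real (bump_conv g \<rho> x)"
    and fourier_transform_bump_conv_weighted_integrable:
      "integrable lborel (\<lambda>\<xi>. (1 + norm \<xi>) * norm (fourier_transform (bump_conv g \<rho>) \<xi>))"
    and fourier_transform_bump_conv_measurable:
      "fourier_transform (bump_conv g \<rho>) \<in> borel_measurable borel"
proof -
  interpret bump_family \<rho> \<delta> by fact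
  let ?c = "complex_of_real (1 / (2 * pi) ^ CARD('d))"
  define G where "G \<xi> = (CLBINT z. iexp (- (z \<bullet> \<xi>)) * complex_of_real (g z))" for \<xi>
  have [measurable]: "g \<in> borel_measurable borel" using g(1) by (rule borel_measurable_continuous_onI)
  have [measurable]: "G \<in> borel_measurable borel" unfolding G_def by measurable
  have eq: "fourier_transform (bump_conv g \<rho>) = (\<lambda>\<xi>. ?c * (G \<xi> * fourier_prod \<rho> \<xi>))"
    unfolding fourier_transform_def G_def using fourier_bump_conv[OF g(1), of r] g(2) by auto
  show "fourier_transform (bump_conv g \<rho>) \<in> borel_measurable borel"
    unfolding eq by measurable
  have "(CLBINT \<xi>. iexp (x \<bullet> \<xi>) * fourier_transform (bump_conv g \<rho>) \<xi>)
      = (CLBINT \<xi>. ?c * (iexp (x \<bullet> \<xi>) * (G \<xi> * fourier_prod \<rho> \<xi>)))"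
    unfolding eq by (simp only: ac_simps)
  also have "\<dots> = ?c * complex_of_real ((2 * pi) ^ DIM(real^'d) * bump_conv g \<rho> x)"
    unfolding integral_mult_right_zero G_def by (subst fourier_bump_conv_inversion[OF g(1), of r]) (use g(2) in auto)
  also have "\<dots> = complex_of_real (1 / (2 * pi) ^ CARD('d) * ((2 * pi) ^ CARD('d) * bump_conv g \<rho> x))"
    by (simp only: of_real_mult DIM_cart DIM_real mult_1_right)
  also have "1 / (2 * pi) ^ CARD('d) * ((2 * pi) ^ CARD('d) * bump_conv g \<rho> x) = bump_conv g \<rho> x"
    by simp
  finally show "(CLBINT \<xi>. iexp (x \<bullet> \<xi>) * fourier_transform (bump_conv g \<rho>) \<xi>) = complex_of_real (bump_conv g \<rho> x)" .
  have G: "norm (G \<xi>) \<le> (\<integral>z. \<bar>g z\<bar> \<partial>lborel)" for \<xi>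
    unfolding G_def by (rule integral_norm_bound[THEN order_trans]) (simp add: norm_mult)
  show "integrable lborel (\<lambda>\<xi>. (1 + norm \<xi>) * norm (fourier_transform (bump_conv g \<rho>) \<xi>))"
  proof (rule Bochner_Integration.integrable_bound)
    show "integrable lborel (\<lambda>\<xi>. (norm ?c * (\<integral>z. \<bar>g z\<bar> \<partial>lborel)) * ((1 + norm \<xi>) * norm (fourier_prod \<rho> \<xi>)))"
      by (intro integrable_mult_right fourier_prod_weighted_integrable)
    have "norm ((1 + norm \<xi>) * norm (fourier_transform (bump_conv g \<rho>) \<xi>))
      = (norm ?c * norm (G \<xi>)) * ((1 + norm \<xi>) * norm (fourier_prod \<rho> \<xi>))" for \<xi>
      unfolding eq
      by (simp only: real_norm_def abs_mult abs_norm_cancel norm_mult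
        abs_of_nonneg[OF add_nonneg_nonneg[OF zero_le_one norm_ge_zero]] ac_simps)
    also have "\<dots> \<xi> \<le> norm ((norm ?c * (\<integral>z. \<bar>g z\<bar> \<partial>lborel)) * ((1 + norm \<xi>) * norm (fourier_prod \<rho> \<xi>)))" for \<xi>
      unfolding real_norm_def
      by (rule order_trans[OF _ abs_ge_self], intro mult_right_mono mult_left_mono G) auto
    finally show "AE \<xi> in lborel. norm ((1 + norm \<xi>) * norm (fourier_transform (bump_conv g \<rho>) \<xi>))
      \<le> norm ((norm ?c * (\<integral>z. \<bar>g z\<bar> \<partial>lborel)) * ((1 + norm \<xi>) * norm (fourier_prod \<rho> \<xi>)))"
      by (intro AE_I2)
  qed (unfold eq, measurable)
qed

section \<open>Closedness of the generator\<close>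

lemma C0_linear:
  assumes "f \<in> C0" "g \<in> C0"
  shows "(\<lambda>x. a * f x + b * g x) \<in> C0"
proof -
  have "((\<lambda>x. a * f x + b * g x) \<longlongrightarrow> a * 0 + b * 0) at_infinity"
    using assms unfolding C0_def by (intro tendsto_intros) auto
  then show ?thesis using assms unfolding C0_def by (auto intro!: continuous_intros)
qed

lemma C0_pos_part: "f \<in> C0 \<Longrightarrow> (\<lambda>x. max (a * f x) 0) \<in> C0"
proof -
  assume f: "f \<in> C0"
  have "((\<lambda>x. max (a * f x) 0) \<longlongrightarrow> max (a * 0) 0) at_infinity"
    using f unfolding C0_def by (intro tendsto_intros) auto
  then show ?thesis using f unfolding C0_def by (auto intro!: continuous_intros)
qed

lemma C0_uniformly_closed:
  assumes approx: "\<And>e. 0 < e \<Longrightarrow> \<exists>w\<in>C0. \<forall>x. \<bar>w x - g x\<bar> \<le> e"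
  shows "g \<in> C0"
proof -
  have "\<exists>w\<in>C0. \<forall>x. \<bar>w x - g x\<bar> \<le> inverse (real (Suc n))" for n
    by (intro approx) simp
  then obtain w where w: "\<And>n. w n \<in> C0" "\<And>n x. \<bar>w n x - g x\<bar> \<le> inverse (real (Suc n))"
    by metis
  have "uniform_limit UNIV w g sequentially"
  proof (rule uniform_limitI)
    fix e :: real assume "0 < e"
    have "\<forall>\<^sub>F n in sequentially. inverse (real (Suc n)) < e"
      using LIMSEQ_inverse_real_of_nat \<open>0 < e\<close> by (rule order_tendstoD)
    then show "\<forall>\<^sub>F n in sequentially. \<forall>x\<in>UNIV. dist (w n x) (g x) < e"
      by eventually_elim (use w(2) in \<open>auto simp: dist_real_def intro: le_less_trans\<close>)
  qed
  then have "continuous_on UNIV g"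
    by (rule uniform_limit_theorem[rotated]) (use w(1) in \<open>auto simp: C0_def\<close>)
  moreover have "(g \<longlongrightarrow> 0) at_infinity"
  proof (rule tendstoI)
    fix e :: real assume "0 < e"
    then obtain v where v: "v \<in> C0" "\<And>x. \<bar>v x - g x\<bar> \<le> e/2" using approx[of "e/2"] by auto
    have "\<forall>\<^sub>F x in at_infinity. dist (v x) 0 < e/2"
      using v(1) \<open>0 < e\<close> unfolding C0_def by (intro tendstoD) auto
    then show "\<forall>\<^sub>F x in at_infinity. dist (g x) 0 < e"
    proof eventually_elim
      case (elim x)
      then show ?case using v(2)[of x] unfolding dist_real_def by linarith
    qed
  qed
  ultimately show ?thesis by (simp add: C0_def)
qed

locale feller =
  fixes T :: "real \<Rightarrow> (real ^ 'd::finite \<Rightarrow> real) \<Rightarrow> real ^ 'd \<Rightarrow> real"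
  assumes feller: "feller_semigroup T"
begin

lemma maps_C0: "0 \<le> t \<Longrightarrow> f \<in> C0 \<Longrightarrow> T t f \<in> C0"
  and linear: "0 \<le> t \<Longrightarrow> f \<in> C0 \<Longrightarrow> g \<in> C0 \<Longrightarrow>
    T t (\<lambda>x. a * f x + b * g x) = (\<lambda>x. a * T t f x + b * T t g x)"
  and at_zero: "f \<in> C0 \<Longrightarrow> T 0 f = f"
  and semigroup: "0 \<le> s \<Longrightarrow> 0 \<le> t \<Longrightarrow> f \<in> C0 \<Longrightarrow> T (s + t) f = T s (T t f)"
  and sub_markov: "0 \<le> t \<Longrightarrow> f \<in> C0 \<Longrightarrow> (\<And>x. 0 \<le> f x \<and> f x \<le> 1) \<Longrightarrow> 0 \<le> T t f x \<and> T t f x \<le> 1"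
  and strongly_continuous: "f \<in> C0 \<Longrightarrow> uniform_limit UNIV (\<lambda>t. T t f) f (at_right 0)"
  using feller unfolding feller_semigroup_def by simp_all

text \<open>The sub-Markov property speaks of functions with values in [0, 1] only. The scaled
  positive and negative parts of \<open>f\<close> are such functions, and the difference of two
  numbers in [0, k] has modulus at most k.\<close>

lemma contraction:
  assumes t: "0 \<le> t" and f: "f \<in> C0" and le: "\<And>x. \<bar>f x\<bar> \<le> c"
  shows "\<bar>T t f x\<bar> \<le> c"
proof (rule field_le_epsilon)
  fix e :: real assume "0 < e"
  \<comment> \<open>The slack \<open>e\<close> keeps the scaling factor positive even for
    \<open>c = 0\<close>.\<close>
  define k where "k = c + e"
  have k: "0 < k" using le[of x] \<open>0 < e\<close> by (simp add: k_def)
  define p where "p x = max ((1/k) * f x) 0" for x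
  define n where "n x = max ((-1/k) * f x) 0" for x
  have C0: "p \<in> C0" "n \<in> C0" unfolding p_def n_def by (intro C0_pos_part f)+
  have fk: "\<bar>f x\<bar> \<le> k" for x using le[of x] \<open>0 < e\<close> by (simp add: k_def)
  have p1: "0 \<le> p x \<and> p x \<le> 1" "0 \<le> n x \<and> n x \<le> 1" for x
    using fk[of x] k by (auto simp: p_def n_def field_simps)
  have "f = (\<lambda>x. k * p x + (- k) * n x)"
    using k by (auto simp: fun_eq_iff p_def n_def max_def field_simps)
  then have "T t f x = k * T t p x + (- k) * T t n x"
    using linear[OF t C0] by metis
  moreover have "0 \<le> k * T t p x \<and> k * T t p x \<le> k * 1" "0 \<le> k * T t n x \<and> k * T t n x \<le> k * 1"
    using sub_markov[OF t C0(1) p1(1), of x] sub_markov[OF t C0(2) p1(2), of x] k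
    by (auto intro: mult_left_mono)
  ultimately have "\<bar>T t f x\<bar> \<le> k" by linarith
  then show "\<bar>T t f x\<bar> \<le> c + e" by (simp only: k_def)
qed

lemma diff: "0 \<le> t \<Longrightarrow> f \<in> C0 \<Longrightarrow> g \<in> C0 \<Longrightarrow> T t (\<lambda>x. f x - g x) x = T t f x - T t g x"
  using linear[of t f g 1 "-1"] by simp

text \<open>Telescoping \<open>T\<^sub>t v - v\<close> over \<open>m\<close> steps of length \<open>t / m\<close> replaces the identity
  \<open>T\<^sub>t v - v = \<integral>\<^sub>0\<^sup>t T\<^sub>s w ds\<close> and avoids integrating in a function space.\<close>

lemma generator_increment_bound:
  assumes v: "v \<in> C0" and w: "generator_limit T v w" and t: "0 < t"
    and osc: "\<And>s x. 0 \<le> s \<Longrightarrow> s \<le> t \<Longrightarrow> \<bar>T s w x - w x\<bar> \<le> \<eta>"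
  shows "\<bar>T t v x - v x - t * w x\<bar> \<le> t * \<eta>"
proof (rule field_le_epsilon)
  fix e :: real assume e: "0 < e"
  have wC0: "w \<in> C0" and lim: "uniform_limit UNIV (\<lambda>t x. (T t v x - v x) / t) w (at_right 0)"
    using w by (auto simp: generator_limit_def)
  have "\<forall>\<^sub>F h in at_right 0. \<forall>x\<in>UNIV. dist ((T h v x - v x) / h) (w x) < e / t"
    using lim e t by (intro uniform_limitD) auto
  then obtain h0 where h0: "0 < h0"
    "\<And>h x. 0 < h \<Longrightarrow> h < h0 \<Longrightarrow> \<bar>(T h v x - v x) / h - w x\<bar> < e / t"
    by (auto simp: eventually_at_right_field dist_real_def)
  obtain m :: nat where m: "t / h0 < real m" using reals_Archimedean2 by blast
  define h where "h = t / real m"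
  have m0: "0 < real m" using m t h0(1) by (meson divide_pos_pos less_trans)
  have h: "0 < h" "h < h0" "real m * h = t"
    using m m0 t h0(1) by (auto simp: h_def field_simps)
  \<comment> \<open>The error of the difference quotient at step \<open>h\<close>. It lies in
    \<open>C0\<close>, so each step of the telescope propagates it by the contraction and the
    increment of \<open>T (j * h) v\<close> is \<open>h\<close> times the images of \<open>w\<close>
    and \<open>r\<close>.\<close>
  define r where "r x = (T h v x - v x) / h - w x" for x
  have r_eq: "r = (\<lambda>x. (1/h) * (1 * T h v x + (-1) * v x) + (-1) * w x)"
    by (auto simp: r_def fun_eq_iff diff_divide_distrib)
  have rC0: "r \<in> C0"
    unfolding r_eq using maps_C0[OF less_imp_le[OF h(1)] v] by (intro C0_linear v wC0)
  have r: "\<bar>r x\<bar> \<le> e / t" for x using h0(2)[OF h(1,2), of x] by (simp add: r_def)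
  have step: "T h v = (\<lambda>x. 1 * (1 * v x + h * w x) + h * r x)"
    using h(1) by (auto simp: fun_eq_iff r_def field_simps)
  have "\<bar>T (real j * h) v x - v x - real j * h * w x\<bar> \<le> real j * h * (\<eta> + e / t)" if "j \<le> m" for j
    using that
  proof (induction j)
    case 0
    then show ?case by (simp add: at_zero[OF v])
  next
    case (Suc j)
    have jh: "0 \<le> real j * h" "real j * h \<le> t"
      using h Suc.prems mult_right_mono[of "real j" "real m" h] by auto
    have "T (real (Suc j) * h) v = T (real j * h) (T h v)"
      using semigroup[OF jh(1) less_imp_le[OF h(1)] v] by (simp add: algebra_simps)
    also have "\<dots> = (\<lambda>x. 1 * T (real j * h) (\<lambda>x. 1 * v x + h * w x) x + h * T (real j * h) r x)"
      by (subst step, rule linear[OF jh(1) C0_linear[OF v wC0] rC0])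
    also have "T (real j * h) (\<lambda>x. 1 * v x + h * w x) = (\<lambda>x. 1 * T (real j * h) v x + h * T (real j * h) w x)"
      by (rule linear[OF jh(1) v wC0])
    finally have "T (real (Suc j) * h) v x - v x - real (Suc j) * h * w x =
        (T (real j * h) v x - v x - real j * h * w x) + h * ((T (real j * h) w x - w x) + T (real j * h) r x)"
      by (simp add: algebra_simps)
    also have "\<bar>\<dots>\<bar> \<le> \<bar>T (real j * h) v x - v x - real j * h * w x\<bar> + h * \<bar>(T (real j * h) w x - w x) + T (real j * h) r x\<bar>"
      using h(1) by (intro order_trans[OF abs_triangle_ineq]) (simp add: abs_mult)
    also have "\<dots> \<le> real j * h * (\<eta> + e / t) + h * (\<eta> + e / t)"
      using Suc.IH Suc.prems h(1) osc[OF jh, of x] contraction[OF jh(1) rC0 r, of x]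
      by (intro add_mono mult_left_mono) auto
    finally show ?case by (simp add: algebra_simps)
  qed
  from this[of m] have "\<bar>T t v x - v x - t * w x\<bar> \<le> t * (\<eta> + e / t)" by (simp only: h(3) order_refl)
  also have "\<dots> = t * \<eta> + e" using t by (simp add: distrib_left)
  finally show "\<bar>T t v x - v x - t * w x\<bar> \<le> t * \<eta> + e" .
qed

text \<open>The time threshold is taken from strong continuity at the limit \<open>g\<close> alone,
  so the approximant may depend on t. That \<open>g\<close> lies in \<open>C0\<close> is part of the
  conclusion and is inherited as a uniform limit.\<close>

lemma generator_closed:
  assumes u: "u \<in> C0"
    and approx: "\<And>e. 0 < e \<Longrightarrow> \<exists>v\<in>C0. \<exists>w. generator_limit T v w \<and>
      (\<forall>x. \<bar>v x - u x\<bar> \<le> e) \<and> (\<forall>x. \<bar>w x - g x\<bar> \<le> e)"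
  shows "generator_limit T u g"
proof -
  have g: "g \<in> C0"
    using approx by (intro C0_uniformly_closed) (metis generator_limit_def)
  have "uniform_limit UNIV (\<lambda>t x. (T t u x - u x) / t) g (at_right 0)"
  proof (rule uniform_limitI)
    fix e' :: real assume "0 < e'"
    \<comment> \<open>The increment bound costs 3 t e, and replacing \<open>T t v\<close>,
      \<open>v\<close> and \<open>t * w\<close> by their counterparts costs t e each; the total 6 t
      e is strictly below 7 t e.\<close>
    define e where "e = e' / 7"
    have e: "0 < e" using \<open>0 < e'\<close> by (simp add: e_def)
    have "\<forall>\<^sub>F t in at_right 0. \<forall>x\<in>UNIV. dist (T t g x) (g x) < e"
      using strongly_continuous[OF g] e by (rule uniform_limitD)
    then obtain d where d: "0 < d" "\<And>s x. 0 < s \<Longrightarrow> s < d \<Longrightarrow> \<bar>T s g x - g x\<bar> < e"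
      by (auto simp: eventually_at_right_field dist_real_def)
    have "\<bar>(T t u x - u x) / t - g x\<bar> < e'" if t: "0 < t" "t < d" for t x
    proof -
      \<comment> \<open>The difference quotient divides by t, so closeness of order t e is
        requested.\<close>
      obtain v w where v: "v \<in> C0" and vw: "generator_limit T v w"
        and vu: "\<And>x. \<bar>v x - u x\<bar> \<le> min e (t * e)" and wg: "\<And>x. \<bar>w x - g x\<bar> \<le> min e (t * e)"
        using approx[of "min e (t * e)"] e t by auto
      have w: "w \<in> C0" using vw by (simp add: generator_limit_def)
      have diffC0: "(\<lambda>x. v x - u x) \<in> C0" "(\<lambda>x. w x - g x) \<in> C0"
        using C0_linear[OF v u, of 1 "-1"] C0_linear[OF w g, of 1 "-1"] by simp_all
      have "\<bar>T s w x - w x\<bar> \<le> 3 * e" if s: "0 \<le> s" "s \<le> t" for s x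
      proof -
        have "\<bar>T s g x - g x\<bar> \<le> e"
          using d(2)[of s x] s t e at_zero[OF g] by (cases "s = 0") auto
        moreover have "\<bar>T s w x - T s g x\<bar> \<le> e"
          using contraction[OF s(1) diffC0(2), of e x] wg diff[OF s(1) w g] by auto
        ultimately show ?thesis using wg[of x] by linarith
      qed
      from generator_increment_bound[OF v vw t(1) this]
      have "\<bar>T t v x - v x - t * w x\<bar> \<le> t * (3 * e)" .
      moreover have "\<bar>T t v x - T t u x\<bar> \<le> t * e"
        using contraction[OF _ diffC0(1), of t "t * e" x] vu diff[OF _ v u, of t] t by auto
      moreover have "\<bar>t * w x - t * g x\<bar> \<le> t * e"
        using wg[of x] t by (auto simp: right_diff_distrib[symmetric] abs_mult intro: mult_left_mono)
      ultimately have "\<bar>T t u x - u x - t * g x\<bar> \<le> 6 * (t * e)"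
        using vu[of x] by linarith
      also have "\<dots> < t * e'" using t \<open>0 < e'\<close> by (simp add: e_def)
      finally have "\<bar>T t u x - u x - t * g x\<bar> / t < e'" using t by (simp add: divide_less_eq mult.commute)
      moreover have "(T t u x - u x) / t - g x = (T t u x - u x - t * g x) / t"
        using t by (simp add: field_simps)
      ultimately show ?thesis using t by (simp add: abs_divide)
    qed
    then show "\<forall>\<^sub>F t in at_right 0. \<forall>x\<in>UNIV. dist ((T t u x - u x) / t) (g x) < e'"
      using d(1) by (auto simp: eventually_at_right_field dist_real_def)
  qed
  with g show ?thesis by (simp add: generator_limit_def)
qed

end

section \<open>The symbol and the jump measures\<close>

lemma fourier_symbol_bound: "norm (1 - iexp t) \<le> \<bar>t\<bar>"
  using iexp_approx1[of t 0] by (simp add: norm_minus_commute)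

lemma fourier_symbol_bound2: "norm (1 - iexp t) \<le> 2"
  by (rule order_trans[OF norm_triangle_ineq4]) simp

text \<open>The jump measure at one fixed point x, with \<open>\<beta>\<close> in the role of
  \<alpha>(x) - \<epsilon>. The bound \<open>\<beta> \<le> 1\<close> makes y integrable near the
  origin.\<close>

locale levy_measure_beta =
  fixes \<nu> :: "'a::euclidean_space measure" and \<beta> :: real
  assumes sets_nu [measurable_cong]: "sets \<nu> = sets borel"
    and null_0: "emeasure \<nu> {0} = 0"
    and levy: "(\<integral>\<^sup>+ y. ennreal (min ((norm y)\<^sup>2) 1) \<partial>\<nu>) < \<infinity>"
    and beta: "0 \<le> \<beta>" "\<beta> \<le> 1"
    and small_jumps: "(\<integral>\<^sup>+ y\<in>{y. 0 < norm y \<and> norm y \<le> 1}. ennreal (norm y powr \<beta>) \<partial>\<nu>) < \<infinity>"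
begin

lemma space_nu [simp]: "space \<nu> = UNIV"
  using sets_nu sets_eq_imp_space_eq by fastforce

lemma AE_nonzero: "AE y in \<nu>. y \<noteq> 0"
  by (rule AE_I'[of "{0}"]) (auto simp: null_sets_def null_0 sets_nu)

lemma emeasure_outside_ball:
  assumes "0 < r" shows "emeasure \<nu> {y. r \<le> norm y} < \<infinity>"
proof -
  define c where "c = min (r\<^sup>2) 1"
  have c: "0 < c" using assms by (simp add: c_def)
  have le: "c \<le> min ((norm y)\<^sup>2) 1" if "r \<le> norm y" for y :: 'a
    unfolding c_def using that assms by (intro min.mono power_mono) auto
  have "ennreal c * emeasure \<nu> {y. r \<le> norm y} = (\<integral>\<^sup>+ y. ennreal c * indicator {y. r \<le> norm y} y \<partial>\<nu>)"
    by (subst nn_integral_cmult_indicator) (auto simp: sets_nu)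
  also have "\<dots> \<le> (\<integral>\<^sup>+ y. ennreal (min ((norm y)\<^sup>2) 1) \<partial>\<nu>)"
    by (intro nn_integral_mono) (use le in \<open>auto simp: indicator_def\<close>)
  also note levy
  finally show ?thesis using c by (auto simp: ennreal_mult_less_top less_top)
qed

text \<open>The measure may be infinite near 0, so Fubini needs an exhaustion: complements of
  shrinking balls have finite mass and the origin is null.\<close>

sublocale sigma_finite_measure \<nu>
proof
  have "\<exists>n. inverse (real (Suc n)) \<le> norm y" if "y \<noteq> 0" for y :: 'a
    using reals_Archimedean[of "norm y"] that by (auto intro: less_imp_le)
  then have "\<Union> (insert {0} (range (\<lambda>n. {y. inverse (real (Suc n)) \<le> norm y}))) = space \<nu>"
    by fastforce
  then show "\<exists>A. countable A \<and> A \<subseteq> sets \<nu> \<and> \<Union> A = space \<nu> \<and> (\<forall>a\<in>A. emeasure \<nu> a \<noteq> \<infinity>)"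
    using emeasure_outside_ball null_0
    by (intro exI[of _ "insert {0} (range (\<lambda>n. {y. inverse (real (Suc n)) \<le> norm y}))"])
      (auto simp: sets_nu less_top)
qed

text \<open>The majorant through which every jump estimate passes; a bound on its integral that is
  uniform in x is what makes those estimates uniform.\<close>

definition weight :: "'a \<Rightarrow> real" where
  "weight y = indicator {y. 0 < norm y \<and> norm y \<le> 1} y * norm y powr \<beta> + indicator {y. 1 < norm y} y"

lemma weight_simps:
  "weight 0 = 0" "0 < norm y \<Longrightarrow> norm y \<le> 1 \<Longrightarrow> weight y = norm y powr \<beta>" "1 < norm y \<Longrightarrow> weight y = 1"
  by (auto simp: weight_def)

lemma weight_nonneg: "0 \<le> weight y"
  by (simp add: weight_def)

lemma weight_measurable [measurable]: "weight \<in> borel_measurable borel"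
  unfolding weight_def[abs_def] by measurable

lemma min_norm_le_weight: "min (norm y) 1 \<le> weight y"
proof -
  consider "y = 0" | "0 < norm y" "norm y \<le> 1" | "1 < norm y" by fastforce
  then show ?thesis
  proof cases
    case 2
    then have "norm y powr 1 \<le> norm y powr \<beta>" using beta by (intro powr_mono') auto
    with 2 show ?thesis by (simp add: weight_simps)
  qed (simp_all add: weight_simps)
qed

lemma nn_integral_weight:
  "(\<integral>\<^sup>+ y. ennreal (weight y) \<partial>\<nu>) =
    (\<integral>\<^sup>+ y\<in>{y. 0 < norm y \<and> norm y \<le> 1}. ennreal (norm y powr \<beta>) \<partial>\<nu>) + emeasure \<nu> {y. 1 < norm y}"
proof -
  have "(\<integral>\<^sup>+ y. ennreal (weight y) \<partial>\<nu>) = (\<integral>\<^sup>+ y. ennreal (norm y powr \<beta>) * indicator {y. 0 < norm y \<and> norm y \<le> 1} y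
      + indicator {y. 1 < norm y} y \<partial>\<nu>)"
    by (intro nn_integral_cong) (auto simp: weight_def indicator_def)
  also have "\<dots> = (\<integral>\<^sup>+ y\<in>{y. 0 < norm y \<and> norm y \<le> 1}. ennreal (norm y powr \<beta>) \<partial>\<nu>) + (\<integral>\<^sup>+ y. indicator {y. 1 < norm y} y \<partial>\<nu>)"
    by (rule nn_integral_add) measurable
  finally show ?thesis by (simp add: sets_nu)
qed

lemma weight_integrable: "integrable \<nu> weight"
proof (rule integrableI_nonneg)
  have "emeasure \<nu> {y. 1 < norm y} \<le> emeasure \<nu> {y. 1 \<le> norm y}"
    by (rule emeasure_mono) (auto simp: sets_nu)
  then have "emeasure \<nu> {y. 1 < norm y} < \<infinity>"
    using emeasure_outside_ball[of 1] by (simp add: order.strict_trans1)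
  then show "(\<integral>\<^sup>+ y. ennreal (weight y) \<partial>\<nu>) < \<infinity>"
    unfolding nn_integral_weight using small_jumps by simp
qed (auto simp: weight_nonneg)

text \<open>|1 - exp(i s)| is at most |s| and at most 2; the first is used for small y, the second
  for large y, to separate the variables.\<close>

lemma iexp_bound_weight: "norm (1 - iexp (y \<bullet> \<xi>)) \<le> (1 + norm \<xi>) * (2 * weight y)"
proof -
  have "norm (1 - iexp (y \<bullet> \<xi>)) \<le> (1 + norm \<xi>) * (2 * min (norm y) 1)"
  proof (cases "norm y \<le> 1")
    case True
    have "norm (1 - iexp (y \<bullet> \<xi>)) \<le> norm y * norm \<xi>"
      using fourier_symbol_bound[of "y \<bullet> \<xi>"] Cauchy_Schwarz_ineq2[of y \<xi>] by linarith
    also have "\<dots> \<le> (1 + norm \<xi>) * (2 * min (norm y) 1)" using True by (simp add: algebra_simps)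
    finally show ?thesis .
  next
    case False
    then show ?thesis using fourier_symbol_bound2[of "y \<bullet> \<xi>"] by (simp add: algebra_simps add_increasing2)
  qed
  also have "\<dots> \<le> (1 + norm \<xi>) * (2 * weight y)"
    using min_norm_le_weight by (intro mult_left_mono) auto
  finally show ?thesis .
qed

lemma integrable_weight_bound:
  fixes h :: "'a \<Rightarrow> 'b::{banach, second_countable_topology}"
  assumes [measurable]: "h \<in> borel_measurable borel" and le: "\<And>y. y \<noteq> 0 \<Longrightarrow> norm (h y) \<le> c * weight y"
  shows "integrable \<nu> h" and "norm (\<integral>y. h y \<partial>\<nu>) \<le> c * integral\<^sup>L \<nu> weight"
proof -
  have AE: "AE y in \<nu>. norm (h y) \<le> c * weight y"
    using AE_nonzero by eventually_elim (rule le)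
  have int: "integrable \<nu> (\<lambda>y. c * weight y)" using weight_integrable by simp
  show h: "integrable \<nu> h"
    by (rule Bochner_Integration.integrable_bound[OF int])
      (use AE in \<open>auto elim!: eventually_mono intro: order_trans[OF _ abs_ge_self]\<close>)
  have "norm (\<integral>y. h y \<partial>\<nu>) \<le> (\<integral>y. c * weight y \<partial>\<nu>)"
    using h int AE by (intro order_trans[OF integral_norm_bound integral_mono_AE]) auto
  then show "norm (\<integral>y. h y \<partial>\<nu>) \<le> c * integral\<^sup>L \<nu> weight" by simp
qed

lemma integrable_iexp: "integrable \<nu> (\<lambda>y. 1 - iexp (y \<bullet> \<xi>))"
  using iexp_bound_weight[of _ \<xi>]
  by (intro integrable_weight_bound(1)[where c = "2 * (1 + norm \<xi>)"]) (auto simp: algebra_simps)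

text \<open>As y is integrable over small jumps, the compensator can be split off the integral; what
  it contributes is cancelled by the drift.\<close>

lemma symbol_without_compensator:
  fixes b :: 'a
  assumes b: "b = (LINT y:{y. 0 < norm y \<and> norm y < 1}|\<nu>. y)"
  shows "- \<i> * complex_of_real (b \<bullet> \<xi>) + (LINT y:UNIV - {0}|\<nu>.
      1 - iexp (y \<bullet> \<xi>) + \<i> * complex_of_real (y \<bullet> \<xi>) * indicator {0<..<1} (norm y))
    = (\<integral>y. 1 - iexp (y \<bullet> \<xi>) \<partial>\<nu>)"
proof -
  define I :: "'a \<Rightarrow> real" where "I = indicator {y. 0 < norm y \<and> norm y < 1}"
  have [measurable]: "I \<in> borel_measurable borel" unfolding I_def by measurable
  have int_small: "integrable \<nu> (\<lambda>y. I y *\<^sub>R y)"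
  proof (rule integrable_weight_bound(1)[where c = 1])
    fix y :: 'a
    have "norm (I y *\<^sub>R y) \<le> min (norm y) 1" by (auto simp: I_def indicator_def)
    then show "norm (I y *\<^sub>R y) \<le> 1 * weight y" using min_norm_le_weight[of y] by linarith
  qed measurable
  have b': "b \<bullet> \<xi> = (\<integral>y. I y *\<^sub>R y \<bullet> \<xi> \<partial>\<nu>)"
    unfolding b set_lebesgue_integral_def I_def[symmetric]
    using int_small by (intro integral_inner_left[symmetric])
  have int2: "integrable \<nu> (\<lambda>y. \<i> * complex_of_real (I y *\<^sub>R y \<bullet> \<xi>))"
    using int_small by (intro integrable_mult_right integrable_of_real integrable_inner_left)
  have "(LINT y:UNIV - {0}|\<nu>. 1 - iexp (y \<bullet> \<xi>) + \<i> * complex_of_real (y \<bullet> \<xi>) * indicator {0<..<1} (norm y))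
     = (\<integral>y. (1 - iexp (y \<bullet> \<xi>)) + \<i> * complex_of_real (I y *\<^sub>R y \<bullet> \<xi>) \<partial>\<nu>)"
    unfolding set_lebesgue_integral_def
    by (intro Bochner_Integration.integral_cong) (auto simp: I_def indicator_def)
  also have "\<dots> = (\<integral>y. 1 - iexp (y \<bullet> \<xi>) \<partial>\<nu>) + (\<integral>y. \<i> * complex_of_real (I y *\<^sub>R y \<bullet> \<xi>) \<partial>\<nu>)"
    by (intro Bochner_Integration.integral_add integrable_iexp int2)
  also have "(\<integral>y. \<i> * complex_of_real (I y *\<^sub>R y \<bullet> \<xi>) \<partial>\<nu>) = \<i> * complex_of_real (b \<bullet> \<xi>)"
    unfolding b' by (simp only: integral_mult_right_zero integral_complex_of_real)
  finally show ?thesis by simp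
qed

text \<open>The weighted integrability of \<open>uh\<close> together with \<open>weight\<close>
  dominates the double integral; after the exchange, inversion at x and at x + y evaluates the inner
  integral.\<close>

lemma pseudo_differential_eq_jump_integral:
  assumes uh: "integrable lborel (\<lambda>\<xi>. (1 + norm \<xi>) * norm (uh \<xi>))"
    and [measurable]: "uh \<in> borel_measurable borel"
    and inv: "\<And>x. (CLBINT \<xi>. iexp (x \<bullet> \<xi>) * uh \<xi>) = complex_of_real (u x)"
  shows "- (CLBINT \<xi>. iexp (x \<bullet> \<xi>) * (\<integral>y. 1 - iexp (y \<bullet> \<xi>) \<partial>\<nu>) * uh \<xi>)
    = complex_of_real (\<integral>y. u (x + y) - u x \<partial>\<nu>)"
proof -
  interpret pair_sigma_finite "lborel :: 'a measure" \<nu> ..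
  define F where "F \<xi> y = iexp (x \<bullet> \<xi>) * (1 - iexp (y \<bullet> \<xi>)) * uh \<xi>" for \<xi> y
  have uh_int: "integrable lborel uh"
    by (rule Bochner_Integration.integrable_bound[OF uh]) (auto simp: abs_mult algebra_simps)
  have iexp_int: "integrable lborel (\<lambda>\<xi>. iexp (z \<bullet> \<xi>) * uh \<xi>)" for z
    by (rule Bochner_Integration.integrable_bound[OF uh_int]) (auto simp: norm_mult)
  have "case_prod F \<in> borel_measurable (lborel \<Otimes>\<^sub>M \<nu>)"
    unfolding F_def case_prod_unfold by measurable
  moreover have "norm (F \<xi> y) \<le> \<bar>(1 + norm \<xi>) * norm (uh \<xi>)\<bar> * \<bar>2 * weight y\<bar>" for \<xi> y
  proof -
    have "norm (F \<xi> y) = norm (1 - iexp (y \<bullet> \<xi>)) * norm (uh \<xi>)" by (simp add: F_def norm_mult)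
    also have "\<dots> \<le> (1 + norm \<xi>) * (2 * weight y) * norm (uh \<xi>)"
      by (intro mult_right_mono iexp_bound_weight) simp
    finally show ?thesis using weight_nonneg[of y] by (simp add: abs_mult ac_simps)
  qed
  ultimately have "integrable (lborel \<Otimes>\<^sub>M \<nu>) (case_prod F)"
    using weight_integrable uh
    by (intro integrable_pair_bound[where f = "\<lambda>\<xi>. (1 + norm \<xi>) * norm (uh \<xi>)" and g = "\<lambda>y. 2 * weight y"]) auto
  note fub = Fubini_integral[OF this]
  have "(CLBINT \<xi>. iexp (x \<bullet> \<xi>) * (\<integral>y. 1 - iexp (y \<bullet> \<xi>) \<partial>\<nu>) * uh \<xi>) = (CLBINT \<xi>. \<integral>y. F \<xi> y \<partial>\<nu>)"
    unfolding F_def integral_mult_right_zero integral_mult_left_zero ..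
  also have "\<dots> = (\<integral>y. (CLBINT \<xi>. F \<xi> y) \<partial>\<nu>)" by (rule fub[symmetric])
  also have "\<dots> = (\<integral>y. complex_of_real (u x - u (x + y)) \<partial>\<nu>)"
  proof (rule Bochner_Integration.integral_cong[OF refl])
    fix y
    have "(CLBINT \<xi>. F \<xi> y) = (CLBINT \<xi>. iexp (x \<bullet> \<xi>) * uh \<xi> - iexp ((x + y) \<bullet> \<xi>) * uh \<xi>)"
    proof (rule Bochner_Integration.integral_cong[OF refl])
      fix \<xi>
      have "iexp ((x + y) \<bullet> \<xi>) = iexp (x \<bullet> \<xi>) * iexp (y \<bullet> \<xi>)"
        by (simp add: exp_add[symmetric] inner_add_left algebra_simps)
      then show "F \<xi> y = iexp (x \<bullet> \<xi>) * uh \<xi> - iexp ((x + y) \<bullet> \<xi>) * uh \<xi>"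
        unfolding F_def by (simp only: right_diff_distrib left_diff_distrib mult_1_right)
    qed
    also have "\<dots> = complex_of_real (u x) - complex_of_real (u (x + y))"
      unfolding inv[symmetric] by (rule Bochner_Integration.integral_diff[OF iexp_int iexp_int])
    finally show "(CLBINT \<xi>. F \<xi> y) = complex_of_real (u x - u (x + y))" by simp
  qed
  also have "\<dots> = complex_of_real (\<integral>y. u x - u (x + y) \<partial>\<nu>)" by (rule integral_complex_of_real)
  also have "(\<integral>y. u x - u (x + y) \<partial>\<nu>) = - (\<integral>y. u (x + y) - u x \<partial>\<nu>)"
    by (subst Bochner_Integration.integral_minus[symmetric]) simp
  finally show ?thesis by simp
qed

text \<open>Averaging \<open>1 - cos (t (y \<bullet> b))\<close> over \<open>t \<in> [0, 2d]\<close> gives at least \<open>1\<close> for some coordinate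
  direction \<open>b\<close> as soon as \<open>\<bar>y\<bar> > 1\<close>, so the tail is controlled by the real part of the symbol.\<close>

lemma large_jumps_bound:
  fixes c :: real
  assumes c: "\<And>\<xi>. norm (\<integral>y. 1 - iexp (y \<bullet> \<xi>) \<partial>\<nu>) \<le> c * (1 + (norm \<xi>)\<^sup>2)"
  shows "emeasure \<nu> {y. 1 < norm y} \<le> ennreal (DIM('a) * (2 * DIM('a) * (c * (1 + (2 * DIM('a))\<^sup>2))))"
proof -
  define d where "d = real DIM('a)"
  have d: "1 \<le> d" by (simp add: d_def Suc_leI)
  interpret pair_sigma_finite "lborel :: real measure" \<nu> ..
  have c0: "0 \<le> c" using c[of 0] by simp
  have cos_int: "(\<integral>\<^sup>+ y. ennreal (1 - cos (y \<bullet> \<xi>)) \<partial>\<nu>) \<le> ennreal (c * (1 + (norm \<xi>)\<^sup>2))" for \<xi>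
  proof -
    have Re: "Re (1 - iexp t) = 1 - cos t" for t by (simp add: Re_exp)
    have int: "integrable \<nu> (\<lambda>y. 1 - cos (y \<bullet> \<xi>))"
      using integrable_Re[OF integrable_iexp[of \<xi>]] by (simp only: Re)
    have "(\<integral>\<^sup>+ y. ennreal (1 - cos (y \<bullet> \<xi>)) \<partial>\<nu>) = ennreal (\<integral>y. 1 - cos (y \<bullet> \<xi>) \<partial>\<nu>)"
      using int by (intro nn_integral_eq_integral) auto
    also have "(\<integral>y. 1 - cos (y \<bullet> \<xi>) \<partial>\<nu>) = Re (\<integral>y. 1 - iexp (y \<bullet> \<xi>) \<partial>\<nu>)"
      by (subst integral_Re[OF integrable_iexp, symmetric]) (simp only: Re)
    also have "ennreal \<dots> \<le> ennreal (c * (1 + (norm \<xi>)\<^sup>2))"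
      by (intro ennreal_leI order_trans[OF complex_Re_le_cmod c])
    finally show ?thesis .
  qed
  \<comment> \<open>The integral equals 2 d - sin (2 d a) / a, where the subtracted term is at most
    1 / |a| <= d. This is why the interval has length 2 d.\<close>
  have avg: "1 \<le> (\<integral>\<^sup>+ t. ennreal (1 - cos (t * a)) * indicator {0..2*d} t \<partial>lborel)"
    if "1 / d \<le> \<bar>a\<bar>" for a
  proof -
    have a: "a \<noteq> 0" using that d by auto
    have "(\<integral>\<^sup>+ t. ennreal (1 - cos (t * a)) * indicator {0..2*d} t \<partial>lborel)
        = ennreal ((2*d - sin ((2*d) * a) / a) - (0 - sin (0 * a) / a))"
      using d a by (intro nn_integral_FTC_Icc) (auto intro!: derivative_eq_intros)
    moreover have "sin ((2*d) * a) / a \<le> 1 / \<bar>a\<bar>"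
      by (rule order_trans[OF abs_ge_self]) (simp add: abs_divide divide_right_mono)
    moreover have "1 / \<bar>a\<bar> \<le> d" using that a d by (simp add: field_simps)
    ultimately show ?thesis using d by simp
  qed
  have "emeasure \<nu> {y. 1 < norm y} = (\<integral>\<^sup>+ y. indicator {y. 1 < norm y} y \<partial>\<nu>)"
    by (simp add: sets_nu)
  also have "\<dots> \<le> (\<integral>\<^sup>+ y. (\<Sum>b\<in>Basis. \<integral>\<^sup>+ t. ennreal (1 - cos (t * (y \<bullet> b))) * indicator {0..2*d} t \<partial>lborel) \<partial>\<nu>)"
  proof (intro nn_integral_mono)
    fix y :: 'a
    let ?A = "\<lambda>b. \<integral>\<^sup>+ t. ennreal (1 - cos (t * (y \<bullet> b))) * indicator {0..2*d} t \<partial>lborel"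
    show "indicator {y. 1 < norm y} y \<le> (\<Sum>b\<in>Basis. ?A b)"
    proof (cases "1 < norm y")
      case True
      have "\<exists>b\<in>Basis. 1 / d \<le> \<bar>y \<bullet> b\<bar>"
      proof (rule ccontr)
        assume "\<not> ?thesis"
        then have "(\<Sum>b\<in>Basis. \<bar>y \<bullet> b\<bar>) \<le> (\<Sum>b\<in>(Basis::'a set). 1 / d)"
          by (intro sum_mono) (auto simp: not_le less_imp_le)
        also have "\<dots> = 1" using d by (simp add: d_def)
        finally show False using True norm_le_l1[of y] by linarith
      qed
      then obtain b where b: "b \<in> Basis" "1 / d \<le> \<bar>y \<bullet> b\<bar>" by blast
      have "1 \<le> ?A b" by (rule avg[OF b(2)])
      also have "\<dots> \<le> (\<Sum>b\<in>Basis. ?A b)" using b(1) by (intro member_le_sum) auto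
      finally show ?thesis using True by simp
    qed simp
  qed
  also have "\<dots> = (\<Sum>b\<in>Basis. \<integral>\<^sup>+ y. (\<integral>\<^sup>+ t. ennreal (1 - cos (t * (y \<bullet> b))) * indicator {0..2*d} t \<partial>lborel) \<partial>\<nu>)"
    by (rule nn_integral_sum) measurable
  also have "\<dots> = (\<Sum>b\<in>Basis. \<integral>\<^sup>+ t. (\<integral>\<^sup>+ y. ennreal (1 - cos (t * (y \<bullet> b))) * indicator {0..2*d} t \<partial>\<nu>) \<partial>lborel)"
    by (intro sum.cong refl Fubini') measurable
  also have "\<dots> \<le> (\<Sum>b\<in>(Basis::'a set). \<integral>\<^sup>+ t. ennreal (c * (1 + (2 * d)\<^sup>2)) * indicator {0..2*d} t \<partial>lborel)"
  proof (intro sum_mono nn_integral_mono)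
    fix b :: 'a and t :: real assume b: "b \<in> Basis"
    show "(\<integral>\<^sup>+ y. ennreal (1 - cos (t * (y \<bullet> b))) * indicator {0..2*d} t \<partial>\<nu>)
        \<le> ennreal (c * (1 + (2 * d)\<^sup>2)) * indicator {0..2*d} t"
    proof (cases "t \<in> {0..2*d}")
      case True
      then have "(\<integral>\<^sup>+ y. ennreal (1 - cos (t * (y \<bullet> b))) * indicator {0..2*d} t \<partial>\<nu>)
          = (\<integral>\<^sup>+ y. ennreal (1 - cos (y \<bullet> (t *\<^sub>R b))) \<partial>\<nu>)" by simp
      also have "\<dots> \<le> ennreal (c * (1 + (norm (t *\<^sub>R b))\<^sup>2))" by (rule cos_int)
      also have "\<dots> \<le> ennreal (c * (1 + (2 * d)\<^sup>2))"
        using True b c0 by (intro ennreal_leI mult_left_mono add_left_mono power_mono) auto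
      finally show ?thesis using True by simp
    qed simp
  qed
  \<comment> \<open>The constant collects d directions, the interval length 2 d and the bound on the
    symbol for |\<xi>| <= 2 d.\<close>
  also have "\<dots> = (\<Sum>b\<in>(Basis::'a set). ennreal (2 * d * (c * (1 + (2 * d)\<^sup>2))))"
    using d c0 by (intro sum.cong refl, subst nn_integral_cmult_indicator)
      (auto simp: ennreal_mult[symmetric] mult.commute)
  also have "\<dots> = ennreal (d * (2 * d * (c * (1 + (2 * d)\<^sup>2))))"
    using d c0 by (subst sum_ennreal) (auto simp: d_def)
  finally show ?thesis by (simp add: d_def)
qed

end

section \<open>Approximation in the Hoelder space of variable order\<close>

context levy_measure_beta
begin

section \<open>Jump integrals of functions with a surplus Hoelder exponent\<close>

lemma integral_weight_le:
  assumes "(\<integral>\<^sup>+ y\<in>{y. 0 < norm y \<and> norm y \<le> 1}. ennreal (norm y powr \<beta>) \<partial>\<nu>) \<le> ennreal k0"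
    and "emeasure \<nu> {y. 1 < norm y} \<le> ennreal k1" and "0 \<le> k0" "0 \<le> k1"
  shows "integral\<^sup>L \<nu> weight \<le> k0 + k1"
proof -
  have "ennreal (integral\<^sup>L \<nu> weight) = (\<integral>\<^sup>+ y. ennreal (weight y) \<partial>\<nu>)"
    using weight_integrable weight_nonneg by (intro nn_integral_eq_integral[symmetric]) auto
  also have "\<dots> \<le> ennreal k0 + ennreal k1"
    unfolding nn_integral_weight by (intro add_mono assms(1,2))
  also have "\<dots> = ennreal (k0 + k1)" using assms(3,4) by simp
  finally show ?thesis using assms(3,4) by (simp only: ennreal_le_iff add_nonneg_nonneg)
qed

lemma jump_integrable:
  assumes [measurable]: "v \<in> borel_measurable borel" and B: "\<And>z. \<bar>v z\<bar> \<le> B"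
    and C: "\<And>y. 0 < norm y \<Longrightarrow> norm y \<le> 1 \<Longrightarrow> \<bar>v (x + y) - v x\<bar> \<le> C * norm y powr (\<beta> + \<epsilon>)"
    and pos: "0 \<le> C" "0 \<le> \<epsilon>"
  shows "integrable \<nu> (\<lambda>y. v (x + y) - v x)"
proof (rule integrable_weight_bound(1)[where c = "C + 2 * B"])
  fix y :: 'a assume "y \<noteq> 0"
  have B0: "0 \<le> B" using B[of x] by linarith
  show "norm (v (x + y) - v x) \<le> (C + 2 * B) * weight y"
  proof (cases "norm y \<le> 1")
    case True
    with \<open>y \<noteq> 0\<close> have "\<bar>v (x + y) - v x\<bar> \<le> C * norm y powr (\<beta> + \<epsilon>)" by (intro C) auto
    also have "\<dots> \<le> C * norm y powr \<beta>"
      using True \<open>y \<noteq> 0\<close> pos by (intro mult_left_mono powr_mono') auto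
    also have "\<dots> \<le> (C + 2 * B) * norm y powr \<beta>" using B0 by (intro mult_right_mono) auto
    finally show ?thesis using True \<open>y \<noteq> 0\<close> by (simp add: weight_simps)
  next
    case False
    have "\<bar>v (x + y) - v x\<bar> \<le> 2 * B" using B[of "x + y"] B[of x] by linarith
    with False pos show ?thesis by (simp add: weight_simps)
  qed
qed measurable

text \<open>For |y| <= \<delta> each increment is bounded separately, and the surplus exponent
  yields \<delta>^\<epsilon>. For |y| > \<delta> the uniform distance \<open>s\<close> is used, with
  \<open>\<delta> \<le> weight y\<close> converting it into a multiple of the weight. The first term
  does not improve as \<open>s\<close> shrinks, so \<delta> has to be fixed before the
  approximant.\<close>

lemma jump_integral_diff_bound:
  assumes v: "v \<in> borel_measurable borel" "\<And>z. \<bar>v z\<bar> \<le> B"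
      "\<And>y. 0 < norm y \<Longrightarrow> norm y \<le> 1 \<Longrightarrow> \<bar>v (x + y) - v x\<bar> \<le> C * norm y powr (\<beta> + \<epsilon>)"
    and w: "w \<in> borel_measurable borel" "\<And>z. \<bar>w z\<bar> \<le> B'"
      "\<And>y. 0 < norm y \<Longrightarrow> norm y \<le> 1 \<Longrightarrow> \<bar>w (x + y) - w x\<bar> \<le> C * norm y powr (\<beta> + \<epsilon>)"
    and vw: "\<And>z. \<bar>v z - w z\<bar> \<le> s"
    and pos: "0 \<le> C" "0 \<le> \<epsilon>" "0 < \<delta>" "\<delta> \<le> 1"
  shows "\<bar>(\<integral>y. v (x + y) - v x \<partial>\<nu>) - (\<integral>y. w (x + y) - w x \<partial>\<nu>)\<bar>
    \<le> (2 * C * \<delta> powr \<epsilon> + 2 * s / \<delta>) * integral\<^sup>L \<nu> weight"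
proof -
  define h where "h y = (v (x + y) - v x) - (w (x + y) - w x)" for y
  have [measurable]: "v \<in> borel_measurable borel" "w \<in> borel_measurable borel" by fact+
  have s0: "0 \<le> s" using vw[of x] by linarith
  have h2s: "\<bar>h y\<bar> \<le> 2 * s" for y
    using vw[of "x + y"] vw[of x] by (simp add: h_def)
  have C\<delta>: "0 \<le> 2 * C * \<delta> powr \<epsilon>" "0 \<le> 2 * s / \<delta>" using pos s0 by auto
  have "norm (\<integral>y. h y \<partial>\<nu>) \<le> (2 * C * \<delta> powr \<epsilon> + 2 * s / \<delta>) * integral\<^sup>L \<nu> weight"
  proof (rule integrable_weight_bound(2))
    fix y :: 'a assume "y \<noteq> 0"
    consider "norm y \<le> \<delta>" | "\<delta> < norm y" by linarith
    then show "norm (h y) \<le> (2 * C * \<delta> powr \<epsilon> + 2 * s / \<delta>) * weight y"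
    proof cases
      case 1
      with \<open>y \<noteq> 0\<close> pos have "\<bar>h y\<bar> \<le> 2 * (C * norm y powr (\<beta> + \<epsilon>))"
        using v(3)[of y] w(3)[of y] by (simp add: h_def)
      also have "\<dots> = 2 * C * norm y powr \<epsilon> * norm y powr \<beta>" by (simp add: powr_add)
      also have "\<dots> \<le> 2 * C * \<delta> powr \<epsilon> * norm y powr \<beta>"
        using 1 pos by (intro mult_right_mono mult_left_mono powr_mono2) auto
      also have "\<dots> \<le> (2 * C * \<delta> powr \<epsilon> + 2 * s / \<delta>) * norm y powr \<beta>"
        using C\<delta> by (intro mult_right_mono) auto
      finally show ?thesis using 1 \<open>y \<noteq> 0\<close> pos by (simp add: weight_simps)
    next
      case 2
      then have "\<delta> \<le> weight y" using min_norm_le_weight[of y] pos by linarith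
      then have "(2 * s / \<delta>) * \<delta> \<le> (2 * s / \<delta>) * weight y"
        using C\<delta> by (intro mult_left_mono)
      then have "2 * s \<le> (2 * s / \<delta>) * weight y" using pos by simp
      also have "\<dots> \<le> (2 * C * \<delta> powr \<epsilon> + 2 * s / \<delta>) * weight y"
        using C\<delta> weight_nonneg by (intro mult_right_mono) auto
      finally show ?thesis using h2s[of y] by simp
    qed
  qed (unfold h_def, measurable)
  moreover have "(\<integral>y. h y \<partial>\<nu>) = (\<integral>y. v (x + y) - v x \<partial>\<nu>) - (\<integral>y. w (x + y) - w x \<partial>\<nu>)"
    unfolding h_def by (intro Bochner_Integration.integral_diff jump_integrable[OF v pos(1,2)] jump_integrable[OF w pos(1,2)])
  ultimately show ?thesis by simp
qed

end

section \<open>Smooth approximants with a uniform Hoelder constant\<close>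

lemma C0_bounded:
  assumes "f \<in> C0" obtains B where "\<And>z. \<bar>f z\<bar> \<le> B"
proof -
  have "\<forall>\<^sub>F z in at_infinity. dist (f z) 0 < 1"
    using assms unfolding C0_def by (intro tendstoD) auto
  then obtain r where r: "\<And>z. r \<le> norm z \<Longrightarrow> \<bar>f z\<bar> < 1"
    by (auto simp: eventually_at_infinity)
  have "bounded (f ` cball 0 r)"
    using assms unfolding C0_def
    by (intro compact_imp_bounded compact_continuous_image) (auto intro: continuous_on_subset)
  then obtain B where "\<And>z. norm z \<le> r \<Longrightarrow> \<bar>f z\<bar> \<le> B"
    unfolding bounded_iff by (auto simp: image_iff) (metis mem_cball_0)
  then have "\<bar>f z\<bar> \<le> max B 1" for z
    using r[of z] by (cases "norm z \<le> r") (auto simp: le_max_iff_disj)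
  then show thesis by (rule that)
qed

text \<open>Soft thresholding reaches compact support without a cutoff function: it is
  a contraction, so every modulus of continuity of \<open>f\<close> is inherited.\<close>

lemma C0_soft_threshold:
  assumes f: "f \<in> C0" and e: "0 < e"
  obtains g r where "continuous_on UNIV g" "\<And>z. r < norm z \<Longrightarrow> g z = 0"
    "\<And>z. \<bar>g z - f z\<bar> \<le> e" "\<And>a b. \<bar>g a - g b\<bar> \<le> \<bar>f a - f b\<bar>"
proof -
  define g where "g z = max (f z - e) 0 - max (- f z - e) 0" for z
  have "\<forall>\<^sub>F z in at_infinity. dist (f z) 0 < e"
    using f e unfolding C0_def by (intro tendstoD) auto
  then obtain r where r: "\<And>z. r \<le> norm z \<Longrightarrow> \<bar>f z\<bar> < e"
    by (auto simp: eventually_at_infinity)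
  show thesis
  proof (rule that)
    show "continuous_on UNIV g"
      unfolding g_def using f by (auto simp: C0_def intro!: continuous_intros)
    show "g z = 0" if "r < norm z" for z
      using r[of z] that by (auto simp: g_def)
    show "\<bar>g z - f z\<bar> \<le> e" for z
      using e unfolding g_def by linarith
    show "\<bar>g a - g b\<bar> \<le> \<bar>f a - f b\<bar>" for a b
      using e unfolding g_def by linarith
  qed
qed

lemma variable_holder_C0_D:
  fixes f \<alpha> :: "real ^ 'd::finite \<Rightarrow> real"
  assumes "f \<in> variable_holder_C0 \<alpha>"
  obtains C where "0 \<le> C"
    "\<And>x y. 0 < norm y \<Longrightarrow> norm y \<le> 1 \<Longrightarrow> \<bar>f (x + y) - f x\<bar> \<le> C * norm y powr \<alpha> x"
proof -
  let ?S = "SUP x. SUP y\<in>{y. 0 < norm y \<and> norm y \<le> 1}. ennreal (\<bar>f (x + y) - f x\<bar> / norm y powr \<alpha> x)"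
  have S: "?S < \<infinity>" using assms by (simp add: variable_holder_C0_def)
  show thesis
  proof (rule that[of "enn2real ?S"])
    fix x y :: "real ^ 'd" assume y: "0 < norm y" "norm y \<le> 1"
    have "ennreal (\<bar>f (x + y) - f x\<bar> / norm y powr \<alpha> x)
        \<le> (SUP y\<in>{y. 0 < norm y \<and> norm y \<le> 1}. ennreal (\<bar>f (x + y) - f x\<bar> / norm y powr \<alpha> x))"
      using y by (intro SUP_upper) auto
    also have "\<dots> \<le> ?S" by (rule SUP_upper) simp
    also have "?S = ennreal (enn2real ?S)" using S by (intro ennreal_enn2real[symmetric]) simp
    finally have "\<bar>f (x + y) - f x\<bar> / norm y powr \<alpha> x \<le> enn2real ?S"
      by (simp only: ennreal_le_iff enn2real_nonneg)
    then show "\<bar>f (x + y) - f x\<bar> \<le> enn2real ?S * norm y powr \<alpha> x"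
      using y by (simp add: pos_divide_le_eq)
  qed simp
qed

text \<open>The Hoelder constant is the given \<open>C\<close>, independent of \<open>e\<close>,
  which is what allows the cut between small and large jumps to be chosen first. Averaging costs no
  constant, only exponent: the bound at x - z holds with \<open>\<alpha> (x - z)\<close>, and |y| <=
  1 lets it be relaxed to \<open>\<alpha> x - \<epsilon>/2\<close>.\<close>

lemma variable_holder_smooth_approx:
  fixes f \<alpha> :: "real ^ 'd::finite \<Rightarrow> real"
  assumes f: "f \<in> C0" and C: "0 \<le> C"
      "\<And>x y. 0 < norm y \<Longrightarrow> norm y \<le> 1 \<Longrightarrow> \<bar>f (x + y) - f x\<bar> \<le> C * norm y powr \<alpha> x"
    and \<alpha>: "\<And>x. \<epsilon> \<le> \<alpha> x" "uniformly_continuous_on UNIV \<alpha>" and \<epsilon>: "0 < \<epsilon>" and e: "0 < e"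
  obtains \<rho> \<delta> g r where "bump_family \<rho> \<delta>" "continuous_on UNIV g" "\<And>z. r < norm z \<Longrightarrow> g z = 0"
    "\<And>x. \<bar>bump_conv g \<rho> x - f x\<bar> \<le> e"
    "\<And>x y. 0 < norm y \<Longrightarrow> norm y \<le> 1 \<Longrightarrow>
      \<bar>bump_conv g \<rho> (x + y) - bump_conv g \<rho> x\<bar> \<le> C * norm y powr (\<alpha> x - \<epsilon>/2)"
proof -
  have "0 < e / 2" using e by simp
  from C0_soft_threshold[OF f this]
  obtain g r where g: "continuous_on UNIV g" "\<And>z. r < norm z \<Longrightarrow> g z = 0"
    and gf: "\<And>z. \<bar>g z - f z\<bar> \<le> e/2" and gg: "\<And>a b. \<bar>g a - g b\<bar> \<le> \<bar>f a - f b\<bar>" by blast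
  have gC: "\<bar>g (x + y) - g x\<bar> \<le> C * norm y powr \<alpha> x" if "0 < norm y" "norm y \<le> 1" for x y
    using gg[of "x + y" x] C(2)[OF that, of x] by linarith
  obtain d where d: "0 < d" "\<And>x x'. dist x' x < d \<Longrightarrow> dist (\<alpha> x') (\<alpha> x) < \<epsilon>/2"
    using \<alpha>(2) \<epsilon> unfolding uniformly_continuous_on_def by (metis UNIV_I half_gt_zero)
  \<comment> \<open>Half of \<open>e\<close> was spent on thresholding; \<open>C + 1\<close> avoids
    a division by 0.\<close>
  define k where "k = (e/2) / (C + 1)"
  have "C + 1 \<noteq> 0" using C(1) by simp
  then have "0 < k" "(C + 1) * k = e/2" using C(1) e unfolding k_def by (simp, metis nonzero_eq_divide_eq mult.commute)
  then have k: "0 < k" "C * k \<le> e/2" by (auto simp: distrib_right)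
  \<comment> \<open>The entries keep z in the range of the Hoelder bound, keep
    \<open>\<eta> < d\<close> strict, and force \<open>C * \<eta> powr \<epsilon>\<close> below e/2.
    The last works at every x because \<open>\<epsilon> \<le> \<alpha> x\<close>.\<close>
  define \<eta> where "\<eta> = Min {1, d/2, k powr (1/\<epsilon>)}"
  have \<eta>: "0 < \<eta>" "\<eta> \<le> 1" "\<eta> < d" "\<eta> \<le> k powr (1/\<epsilon>)"
    using d(1) k by (auto simp: \<eta>_def min_def)
  have "\<eta> powr \<epsilon> \<le> (k powr (1/\<epsilon>)) powr \<epsilon>" using \<eta> \<epsilon> by (intro powr_mono2) auto
  also have "\<dots> = k" using k \<epsilon> by (simp add: powr_powr)
  finally have \<eta>k: "\<eta> powr \<epsilon> \<le> k" .
  \<comment> \<open>A product of bumps of radius \<open>\<delta>\<close> lives in the ball of radius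
    \<open>\<delta>\<close> times the dimension.\<close>
  define \<delta> where "\<delta> = \<eta> / DIM(real^'d)"
  have "0 < \<delta>" using \<eta> by (simp add: \<delta>_def)
  then obtain \<rho>1 where \<rho>1: "smooth_real \<rho>1" "\<And>x. 0 \<le> \<rho>1 x" "\<And>x. \<delta> < \<bar>x\<bar> \<Longrightarrow> \<rho>1 x = 0"
    "integrable lborel \<rho>1" "integral\<^sup>L lborel \<rho>1 = 1"
    using bump_exists by blast
  define \<rho> where "\<rho> = (\<lambda>_::real^'d. \<rho>1)"
  have fam: "bump_family \<rho> \<delta>"
    by standard (auto simp: \<rho>_def \<rho>1)
  interpret bump_family \<rho> \<delta> by (rule fam)
  have \<delta>\<eta>: "DIM(real^'d) * \<delta> = \<eta>" by (simp add: \<delta>_def)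
  have avg: "\<bar>\<integral>z. h z * bump z \<partial>lborel\<bar> \<le> e'" if "\<And>z. norm z \<le> \<eta> \<Longrightarrow> \<bar>h z\<bar> \<le> e'" for h e'
    unfolding \<rho>_def using that \<rho>1 by (intro mollifier_average_bound[of \<rho>1 \<delta> h e']) (auto simp: \<delta>\<eta> simp del: DIM_cart)
  have u: "bump_conv g \<rho> x = (\<integral>z. g (x - z) * bump z \<partial>lborel)" for x
    by (rule bump_conv_reflect[OF g(1) smooth])
  have bump_int: "integrable lborel bump"
    by (rule integrable_lborel_Basis_prod[OF integrable_coordinate])
  have bump1: "(\<integral>z. bump z \<partial>lborel) = 1"
    by (subst integral_lborel_Basis_prod[OF integrable_coordinate]) (auto simp: \<rho>_def \<rho>1)
  have int: "integrable lborel (\<lambda>z. g (x - z) * bump z)" for x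
  proof (rule integrable_compact_support[of _ \<eta>])
    show "continuous_on UNIV (\<lambda>z. g (x - z) * bump z)"
      by (intro continuous_on_mult bump_continuous continuous_on_compose2[OF g(1)])
        (auto intro!: continuous_intros)
    show "g (x - z) * bump z = 0" if "\<eta> < norm z" for z
      using Basis_prod_eq_0[of \<delta> \<rho> z] support that by (simp add: \<delta>\<eta>[symmetric])
  qed
  show thesis
  proof (rule that)
    show "bump_family \<rho> \<delta>" by (rule fam)
    show "continuous_on UNIV g" by (rule g(1))
    show "g z = 0" if "r < norm z" for z using that by (rule g(2))
  next
    fix x
    have "\<bar>\<integral>z. (g (x - z) - g x) * bump z \<partial>lborel\<bar> \<le> e/2"
    proof (rule avg)
      fix z :: "real^'d" assume z: "norm z \<le> \<eta>"
      show "\<bar>g (x - z) - g x\<bar> \<le> e/2"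
      proof (cases "z = 0")
        case False
        then have "\<bar>g (x + (- z)) - g x\<bar> \<le> C * norm (- z) powr \<alpha> x" using z \<eta> by (intro gC) auto
        also have "\<dots> \<le> C * norm z powr \<epsilon>"
          unfolding norm_minus_cancel using C(1) z \<eta> \<alpha>(1) by (intro mult_left_mono powr_mono') auto
        also have "\<dots> \<le> C * \<eta> powr \<epsilon>"
          using C(1) z \<epsilon> by (intro mult_left_mono powr_mono2) auto
        also have "\<dots> \<le> C * k" using C(1) \<eta>k by (intro mult_left_mono)
        finally show ?thesis using k(2) by simp
      qed (use e in simp)
    qed
    also have "(\<integral>z. (g (x - z) - g x) * bump z \<partial>lborel) = (\<integral>z. g (x - z) * bump z \<partial>lborel) - (\<integral>z. g x * bump z \<partial>lborel)"
      unfolding left_diff_distrib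
      by (intro Bochner_Integration.integral_diff int integrable_mult_right bump_int)
    also have "\<dots> = bump_conv g \<rho> x - g x" by (simp only: u integral_mult_right_zero bump1 mult_1_right)
    finally show "\<bar>bump_conv g \<rho> x - f x\<bar> \<le> e" using gf[of x] by linarith
  next
    fix x y :: "real^'d" assume y: "0 < norm y" "norm y \<le> 1"
    have "\<bar>\<integral>z. (g (x + y - z) - g (x - z)) * bump z \<partial>lborel\<bar> \<le> C * norm y powr (\<alpha> x - \<epsilon>/2)"
    proof (rule avg)
      fix z :: "real^'d" assume z: "norm z \<le> \<eta>"
      have "dist (x - z) x < d" using z \<eta> by (simp add: dist_norm)
      then have "\<alpha> x - \<epsilon>/2 \<le> \<alpha> (x - z)" using d(2)[of "x - z" x] unfolding dist_real_def by linarith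
      then have "C * norm y powr \<alpha> (x - z) \<le> C * norm y powr (\<alpha> x - \<epsilon>/2)"
        using C(1) y by (intro mult_left_mono powr_mono') auto
      then show "\<bar>g (x + y - z) - g (x - z)\<bar> \<le> C * norm y powr (\<alpha> x - \<epsilon>/2)"
        using gC[OF y, of "x - z"] by (simp add: algebra_simps)
    qed
    also have "(\<integral>z. (g (x + y - z) - g (x - z)) * bump z \<partial>lborel) = bump_conv g \<rho> (x + y) - bump_conv g \<rho> x"
      unfolding left_diff_distrib u by (intro Bochner_Integration.integral_diff int)
    finally show "\<bar>bump_conv g \<rho> (x + y) - bump_conv g \<rho> x\<bar> \<le> C * norm y powr (\<alpha> x - \<epsilon>/2)" .
  qed
qed

text \<open>Integrability is claimed alongside the formula because the integral of a non-integrable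
  function is 0 by convention.\<close>

theorem corollary5p2:
  fixes M :: "'w measure" and P :: "real ^ 'd::finite \<Rightarrow> 'w measure"
    and X :: "real \<Rightarrow> 'w \<Rightarrow> real ^ 'd"
    and q :: "real ^ 'd \<Rightarrow> real ^ 'd \<Rightarrow> complex"
    and b :: "real ^ 'd \<Rightarrow> real ^ 'd" and \<nu> :: "real ^ 'd \<Rightarrow> (real ^ 'd) measure"
    and \<alpha> :: "real ^ 'd \<Rightarrow> real" and \<epsilon> :: real
  assumes "levy_type_process M P X"
    and "rich (transition_semigroup P X)"
    and "has_symbol (transition_semigroup P X) q"
    and "\<And>x. q x 0 = 0"
    and "has_characteristics q b (\<lambda>x. 0) \<nu>"
    and "bounded_coefficients q"
    and "\<And>x. b x = (LINT y:{y. 0 < norm y \<and> norm y < 1}|\<nu> x. y)"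
    and "0 < \<epsilon>"
    and "\<And>x. \<alpha> x \<in> {\<epsilon>..1}"
    and "uniformly_continuous_on UNIV \<alpha>"
    and "(SUP x. \<integral>\<^sup>+ y\<in>{y. 0 < norm y \<and> norm y \<le> 1}. ennreal (norm y powr (\<alpha> x - \<epsilon>)) \<partial>\<nu> x) < \<infinity>"
    and "sector_condition q \<or> (\<forall>x. blumenthal_getoor_infty q x \<le> \<alpha> x - \<epsilon>)"
  shows "variable_holder_C0 \<alpha> \<subseteq> generator_domain (transition_semigroup P X) \<and>
    (\<forall>f\<in>variable_holder_C0 \<alpha>. \<forall>x.
       set_integrable (\<nu> x) (UNIV - {0}) (\<lambda>y. f (x + y) - f x) \<and>
       generator (transition_semigroup P X) f x
         = (LINT y:UNIV - {0}|\<nu> x. f (x + y) - f x))"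
proof -
  let ?T = "transition_semigroup P X"
  interpret feller ?T
    using assms(1) by (simp add: feller_def levy_type_process_def levy_type_process_axioms_def)
  have \<alpha>: "\<epsilon> \<le> \<alpha> x" "\<alpha> x \<le> 1" for x using assms(9)[of x] by auto
  let ?A = "{y::real^'d. 0 < norm y \<and> norm y \<le> 1}"
  let ?S = "SUP x. \<integral>\<^sup>+ y\<in>?A. ennreal (norm y powr (\<alpha> x - \<epsilon>)) \<partial>\<nu> x"
  define k0 where "k0 = enn2real ?S"
  have small: "(\<integral>\<^sup>+ y\<in>?A. ennreal (norm y powr (\<alpha> x - \<epsilon>)) \<partial>\<nu> x) \<le> ennreal k0" for x
  proof -
    have "(\<integral>\<^sup>+ y\<in>?A. ennreal (norm y powr (\<alpha> x - \<epsilon>)) \<partial>\<nu> x) \<le> ?S" by (rule SUP_upper) simp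
    also have "?S = ennreal k0" using assms(11) by (simp add: k0_def)
    finally show ?thesis .
  qed
  have lm: "levy_measure_beta (\<nu> x) (\<alpha> x - \<epsilon>)" for x
    using assms(5) \<alpha>[of x] assms(8) small[of x] le_less_trans[OF small[of x] ennreal_less_top]
    unfolding has_characteristics_def levy_triplet_def by unfold_locales auto
  have q: "q x \<xi> = (\<integral>y. 1 - iexp (y \<bullet> \<xi>) \<partial>\<nu> x)" for x \<xi>
    using assms(5) levy_measure_beta.symbol_without_compensator[OF lm assms(7), of x \<xi>] assms(4)
    unfolding has_characteristics_def by simp
  obtain c where c: "\<And>x \<xi>. norm (q x \<xi>) \<le> c * (1 + (norm \<xi>)\<^sup>2)"
    using assms(6) unfolding bounded_coefficients_def by blast
  define D where "D = real DIM(real^'d)"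
  \<comment> \<open>The tail bound of \<open>large_jumps_bound\<close>, the same for all x because
    \<open>c\<close> is.\<close>
  define k1 where "k1 = D * (2 * D * (c * (1 + (2 * D)\<^sup>2)))"
  have "0 \<le> c" using c[of 0 0] order_trans[OF norm_ge_zero] by fastforce
  then have k: "0 \<le> k0" "0 \<le> k1" by (simp_all add: k0_def k1_def D_def)
  have weight: "integral\<^sup>L (\<nu> x) (levy_measure_beta.weight (\<alpha> x - \<epsilon>)) \<le> k0 + k1" for x
    using levy_measure_beta.large_jumps_bound[OF lm, of x c] c[of x]
    by (intro levy_measure_beta.integral_weight_le[OF lm small] k) (simp add: q k1_def D_def)
  define J where "J f x = (\<integral>y. f (x + y) - f x \<partial>\<nu> x)" for f :: "real^'d \<Rightarrow> real" and x
  \<comment> \<open>Richness provides some generator limit \<open>w\<close>, already in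
    \<open>C0\<close>; the symbol then identifies it pointwise with the jump integral.\<close>
  have gen: "generator_limit ?T (bump_conv g \<rho>) (J (bump_conv g \<rho>)) \<and> bump_conv g \<rho> \<in> C0"
    if \<rho>: "bump_family \<rho> \<delta>" and g: "continuous_on UNIV g" "\<And>z. r < norm z \<Longrightarrow> g z = 0" for g r \<rho> \<delta>
  proof -
    let ?u = "bump_conv g \<rho>"
    have u: "?u \<in> Cc_infty"
      using \<rho> by (intro bump_conv_Cc_infty[OF g]) (auto simp: bump_family_def)
    then have dom: "?u \<in> generator_domain ?T" using assms(2) by (auto simp: rich_def)
    then obtain w where w: "generator_limit ?T ?u w" by (auto simp: generator_domain_def)
    have "w x = J ?u x" for x
    proof -
      have "complex_of_real (w x) = - (CLBINT \<xi>. iexp (x \<bullet> \<xi>) * q x \<xi> * fourier_transform ?u \<xi>)"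
        using assms(3) u generator_eqI[OF w] unfolding has_symbol_def by auto
      also have "\<dots> = complex_of_real (J ?u x)"
        unfolding q J_def using g
        by (intro levy_measure_beta.pseudo_differential_eq_jump_integral[OF lm]
          fourier_transform_bump_conv[OF \<rho>]) auto
      finally show ?thesis by simp
    qed
    then have "w = J ?u" by auto
    with w dom show ?thesis by (auto simp: generator_domain_def)
  qed
  have main: "generator_limit ?T f (J f) \<and> (\<forall>x. integrable (\<nu> x) (\<lambda>y. f (x + y) - f x))"
    if f: "f \<in> variable_holder_C0 \<alpha>" for f
  proof -
    have fC0: "f \<in> C0" using f by (simp add: variable_holder_C0_def)
    have meas: "v \<in> borel_measurable borel" if "v \<in> C0" for v :: "real^'d \<Rightarrow> real"
      using that unfolding C0_def by (intro borel_measurable_continuous_onI) auto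
    obtain B where B: "\<And>z. \<bar>f z\<bar> \<le> B" using C0_bounded[OF fC0] by blast
    obtain C where C: "0 \<le> C"
      "\<And>x y. 0 < norm y \<Longrightarrow> norm y \<le> 1 \<Longrightarrow> \<bar>f (x + y) - f x\<bar> \<le> C * norm y powr \<alpha> x"
      using variable_holder_C0_D[OF f] by blast
    \<comment> \<open>Lowers the exponent of \<open>f\<close> to the one its approximants share,
      written as \<beta> plus the surplus \<epsilon>/2.\<close>
    have fC: "\<bar>f (x + y) - f x\<bar> \<le> C * norm y powr ((\<alpha> x - \<epsilon>) + \<epsilon>/2)"
      if "0 < norm y" "norm y \<le> 1" for x y
    proof -
      have "C * norm y powr \<alpha> x \<le> C * norm y powr ((\<alpha> x - \<epsilon>) + \<epsilon>/2)"
        using C(1) that assms(8) by (intro mult_left_mono powr_mono') auto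
      with C(2)[OF that, of x] show ?thesis by linarith
    qed
    have "generator_limit ?T f (J f)"
    proof (rule generator_closed[OF fC0])
      fix e :: real assume e: "0 < e"
      \<comment> \<open>The added 1 makes the bound positive, so that it can be divided by.\<close>
      define k where "k = k0 + k1 + 1"
      have k_pos: "0 < k" using k by (simp add: k_def)
      \<comment> \<open>Solves 2 (C + 1) \<delta>^(\<epsilon>/2) k = e/2, capped at 1; it depends on
        \<open>C\<close> and \<open>e\<close> but not on the approximant.\<close>
      define \<delta> where "\<delta> = min 1 ((e / (4 * (C + 1) * k)) powr (2 / \<epsilon>))"
      have \<delta>: "0 < \<delta>" "\<delta> \<le> 1" using e C(1) k_pos by (auto simp: \<delta>_def)
      have "\<delta> powr (\<epsilon>/2) \<le> ((e / (4 * (C + 1) * k)) powr (2 / \<epsilon>)) powr (\<epsilon>/2)"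
        using \<delta> assms(8) by (intro powr_mono2) (auto simp: \<delta>_def)
      also have "\<dots> = e / (4 * (C + 1) * k)"
        using assms(8) e C(1) k_pos by (simp add: powr_powr)
      finally have "2 * C * \<delta> powr (\<epsilon>/2) * k \<le> 2 * (C + 1) * (e / (4 * (C + 1) * k)) * k"
        using C(1) k_pos by (intro mult_right_mono mult_mono) auto
      also have "\<dots> = e / 2"
      proof -
        have "2 * m * (e / (4 * m * k)) * k = e / 2" if "m \<noteq> 0" for m
          using that k_pos by (simp add: field_simps)
        from this[of "C + 1"] show ?thesis using C(1) by simp
      qed
      finally have small_part: "2 * C * \<delta> powr (\<epsilon>/2) * k \<le> e / 2" .
      \<comment> \<open>The first entry keeps the approximant within \<open>e\<close> of
        \<open>f\<close>, the second pays for the division by \<delta> in the large-jump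
        term.\<close>
      define s where "s = min e (\<delta> * e / (4 * k))"
      have s: "0 < s" "s \<le> e" using e \<delta> k_pos by (auto simp: s_def)
      have "2 * s / \<delta> * k \<le> 2 * (\<delta> * e / (4 * k)) / \<delta> * k"
        using \<delta> k_pos by (intro mult_right_mono divide_right_mono) (auto simp: s_def)
      also have "\<dots> = e / 2" using \<delta> k_pos by (simp add: field_simps)
      finally have large_part: "2 * s / \<delta> * k \<le> e / 2" .
      obtain \<rho> \<delta>' g r where fam: "bump_family \<rho> \<delta>'" and g: "continuous_on UNIV g" "\<And>z. r < norm z \<Longrightarrow> g z = 0"
        and uf: "\<And>x. \<bar>bump_conv g \<rho> x - f x\<bar> \<le> s"
        and uC: "\<And>x y. 0 < norm y \<Longrightarrow> norm y \<le> 1 \<Longrightarrow>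
          \<bar>bump_conv g \<rho> (x + y) - bump_conv g \<rho> x\<bar> \<le> C * norm y powr (\<alpha> x - \<epsilon>/2)"
        by (rule variable_holder_smooth_approx[where f = f and \<alpha> = \<alpha> and C = C and \<epsilon> = \<epsilon> and e = s],
            rule fC0, rule C(1), erule (1) C(2), rule \<alpha>(1), rule assms(10), rule assms(8), rule s(1), rule that, blast+)
      define u where "u = bump_conv g \<rho>"
      have u: "generator_limit ?T u (J u)" "u \<in> C0"
        using gen[of \<rho> \<delta>' g r] fam g unfolding u_def by auto
      obtain B' where B': "\<And>z. \<bar>u z\<bar> \<le> B'" using C0_bounded[OF u(2)] by blast
      have "\<bar>J u x - J f x\<bar> \<le> e" for x
      proof -
        interpret levy_measure_beta "\<nu> x" "\<alpha> x - \<epsilon>" by (rule lm)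
        have "\<bar>J u x - J f x\<bar> \<le> (2 * C * \<delta> powr (\<epsilon>/2) + 2 * s / \<delta>) * integral\<^sup>L (\<nu> x) weight"
          unfolding J_def
          by (rule jump_integral_diff_bound[OF meas[OF u(2)] B' _ meas[OF fC0] B fC])
            (use uC uf C(1) \<delta> assms(8) in \<open>auto simp: u_def\<close>)
        also have "\<dots> \<le> (2 * C * \<delta> powr (\<epsilon>/2) + 2 * s / \<delta>) * k"
          using weight[of x] C(1) s(1) \<delta> by (intro mult_left_mono add_nonneg_nonneg) (auto simp: k_def)
        also have "\<dots> \<le> e" using small_part large_part by (simp add: distrib_right)
        finally show ?thesis .
      qed
      moreover have "\<bar>u x - f x\<bar> \<le> e" for x using uf[of x] s(2) by (simp add: u_def)
      ultimately show "\<exists>v\<in>C0. \<exists>w. generator_limit ?T v w \<and> (\<forall>x. \<bar>v x - f x\<bar> \<le> e) \<and> (\<forall>x. \<bar>w x - J f x\<bar> \<le> e)"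
        using u by blast
    qed
    moreover have "integrable (\<nu> x) (\<lambda>y. f (x + y) - f x)" for x
      by (rule levy_measure_beta.jump_integrable[OF lm meas[OF fC0] B fC]) (use C(1) assms(8) in auto)
    ultimately show ?thesis by blast
  qed
  \<comment> \<open>At y = 0 the integrand is already 0, so removing the origin does not change
    it.\<close>
  have drop: "(\<lambda>y. indicator (UNIV - {0}) y *\<^sub>R (f (x + y) - f x)) = (\<lambda>y. f (x + y) - f x)"
    for f :: "real^'d \<Rightarrow> real" and x
  proof
    show "indicator (UNIV - {0}) y *\<^sub>R (f (x + y) - f x) = f (x + y) - f x" for y
      by (cases "y = 0") simp_all
  qed
  show ?thesis
  proof (intro conjI subsetI ballI allI)
    fix f assume f: "f \<in> variable_holder_C0 \<alpha>"
    then have "f \<in> C0" by (simp add: variable_holder_C0_def)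
    then show "f \<in> generator_domain ?T" using main[OF f] by (auto simp: generator_domain_def)
    fix x
    show "set_integrable (\<nu> x) (UNIV - {0}) (\<lambda>y. f (x + y) - f x)"
      unfolding set_integrable_def drop using main[OF f] by blast
    show "generator ?T f x = (LINT y:UNIV - {0}|\<nu> x. f (x + y) - f x)"
      unfolding set_lebesgue_integral_def drop
      using generator_eqI[OF conjunct1[OF main[OF f]]] by (simp add: J_def)
  qed
qed

end
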